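(* Let $\Lambda$ be a finite $k$-graph with no sources. Suppose $\Lambda^\infty$ carries two $\Lambda$-projective systems with the standard prefixing maps $\{\sigma_\lambda\}$ and coding maps $\{\sigma^n\}$, one with respect to a measure $\mu$ and non-negative functions $\{f_\lambda\}$, the other with respect to a measure $\mu'$ and non-negative functions $\{f'_\lambda\}$. Let $T_\lambda f=f_\lambda\cdot(f\circ\sigma^{d(\lambda)})$ on $L^2(\Lambda^\infty,\mu)$ and $T'_\lambda f=f'_\lambda\cdot(f\circ\sigma^{d(\lambda)})$ on $L^2(\Lambda^\infty,\mu')$ be the associated representations of $C^*(\Lambda)$. Then these two representations are disjoint if and only if $\mu$ and $\mu'$ are mutually singular.
   Context: $k$-graph: countable small category with degree functor $d:\Lambda\to\mathbb N^k$ with unique factorization; finite, no sources. $\Lambda^\infty$ infinite paths (degree-preserving functors from $\Omega_k$), cylinder sets $Z(\lambda)$, Borel $\sigma$-algebra. Standard coding maps $\sigma^m(x)(p,q)=x(p+m,q+m)$; standard prefixing maps $\sigma_\lambda:Z(s(\lambda))\to Z(\lambda)$, $x\mapsto\lambda x$. A $\Lambda$-semibranching function system on a measure space: sets $D_\lambda$, prefixing maps $\tau_\lambda$ with ranges $R_\lambda$, coding maps $\tau^m$, with: for each $m$ the $R_\lambda$, $\lambda\in\Lambda^m$, a.e. partition the space, $\tau^m\tau_\lambda=\mathrm{id}_{D_\lambda}$, $\mu\circ\tau_\lambda\ll\mu$ with positive derivative on $D_\lambda$; $\tau_v=\mathrm{id}$, $\mu(D_v)>0$; $\tau_\lambda\tau_\nu=\tau_{\lambda\nu}$,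 $R_\nu\subseteq D_\lambda$ a.e.; $\tau^m\tau^n=\tau^{m+n}$. A $\Lambda$-projective system adds functions $f_\lambda\in L^2$ with $|f_\lambda|^2=d(\mu\circ\tau_\lambda^{-1})/d\mu$ (push-forward; nonzero a.e. on $R_\lambda$) and $f_\lambda(f_\nu\circ\tau^{d(\lambda)})=f_{\lambda\nu}$ when $s(\lambda)=r(\nu)$; the operators $f\mapsto f_\lambda\cdot(f\circ\tau^{d(\lambda)})$ then form a representation of $C^*(\Lambda)$. Two representations are disjoint if no nonzero subrepresentation of one is unitarily equivalent to a subrepresentation of the other. *)

theory Defs
  imports "HOL-Probability.Probability" "HOL-Library.Function_Algebras"
begin

text \<open>A k-graph is a countable small category with a degree functor to N^k
  (N^k rendered as 'k => nat for a finite index type 'k, so k = CARD('k))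
  with the unique factorisation property.  Objects are identified with
  their identity morphisms (the vertices); rng and src are range and source.\<close>

record ('a, 'k) kgraph =
  Mor :: "'a set"
  rng :: "'a \<Rightarrow> 'a"
  src :: "'a \<Rightarrow> 'a"
  cmp :: "'a \<Rightarrow> 'a \<Rightarrow> 'a"
  deg :: "'a \<Rightarrow> 'k \<Rightarrow> nat"

definition vertex :: "('a, 'k) kgraph \<Rightarrow> 'a \<Rightarrow> bool" where
  "vertex G v \<longleftrightarrow> v \<in> Mor G \<and> rng G v = v"

definition is_kgraph :: "('a, 'k::finite) kgraph \<Rightarrow> bool" where
  "is_kgraph G \<longleftrightarrow>
     countable (Mor G) \<and>
     (\<forall>l\<in>Mor G. vertex G (rng G l) \<and> vertex G (src G l)) \<and>
     (\<forall>v. vertex G v \<longrightarrow> src G v = v) \<and>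
     (\<forall>l\<in>Mor G. cmp G (rng G l) l = l \<and> cmp G l (src G l) = l) \<and>
     (\<forall>l\<in>Mor G. \<forall>n\<in>Mor G. src G l = rng G n \<longrightarrow>
        cmp G l n \<in> Mor G \<and> rng G (cmp G l n) = rng G l \<and>
        src G (cmp G l n) = src G n \<and> deg G (cmp G l n) = deg G l + deg G n) \<and>
     (\<forall>l\<in>Mor G. \<forall>n\<in>Mor G. \<forall>m\<in>Mor G. src G l = rng G n \<longrightarrow> src G n = rng G m \<longrightarrow>
        cmp G (cmp G l n) m = cmp G l (cmp G n m)) \<and>
     (\<forall>l\<in>Mor G. \<forall>m n. deg G l = m + n \<longrightarrow>
        (\<exists>!p. fst p \<in> Mor G \<and> snd p \<in> Mor G \<and> src G (fst p) = rng G (snd p) \<and>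
              deg G (fst p) = m \<and> deg G (snd p) = n \<and> cmp G (fst p) (snd p) = l))"

definition finite_kgraph :: "('a, 'k) kgraph \<Rightarrow> bool" where
  "finite_kgraph G \<longleftrightarrow> (\<forall>n. finite {l \<in> Mor G. deg G l = n})"

definition no_sources :: "('a, 'k) kgraph \<Rightarrow> bool" where
  "no_sources G \<longleftrightarrow> (\<forall>v n. vertex G v \<longrightarrow> (\<exists>l\<in>Mor G. rng G l = v \<and> deg G l = n))"

text \<open>An infinite path is a degree-preserving functor from Omega_k, whose
  morphisms are pairs (p,q) with p \<le> q; we store it as a function of (p,q)
  which is undefined off the domain.\<close>

type_synonym ('a, 'k) ipath = "('k \<Rightarrow> nat) \<Rightarrow> ('k \<Rightarrow> nat) \<Rightarrow> 'a"

definition ipaths :: "('a, 'k) kgraph \<Rightarrow> ('a, 'k) ipath set" where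
  "ipaths G = {x.
     (\<forall>p q. \<not> p \<le> q \<longrightarrow> x p q = undefined) \<and>
     (\<forall>p q. p \<le> q \<longrightarrow> x p q \<in> Mor G \<and> deg G (x p q) = q - p \<and>
                      rng G (x p q) = x p p \<and> src G (x p q) = x q q) \<and>
     (\<forall>p q t. p \<le> q \<longrightarrow> q \<le> t \<longrightarrow> cmp G (x p q) (x q t) = x p t)}"

definition cyl :: "('a, 'k) kgraph \<Rightarrow> 'a \<Rightarrow> ('a, 'k) ipath set" where
  "cyl G l = {x \<in> ipaths G. x 0 (deg G l) = l}"

text \<open>Borel sigma-algebra of the path space (generated by the cylinder sets,
  which form a countable basis of the topology).\<close>
definition path_space :: "('a, 'k) kgraph \<Rightarrow> ('a, 'k) ipath measure" where
  "path_space G = sigma (ipaths G) (cyl G ` Mor G)"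

definition shift :: "('k \<Rightarrow> nat) \<Rightarrow> ('a, 'k) ipath \<Rightarrow> ('a, 'k) ipath" where
  "shift m x = (\<lambda>p q. if p \<le> q then x (p + m) (q + m) else undefined)"

definition prefix :: "('a, 'k) kgraph \<Rightarrow> 'a \<Rightarrow> ('a, 'k) ipath \<Rightarrow> ('a, 'k) ipath" where
  "prefix G l x = (THE y. y \<in> ipaths G \<and> y 0 (deg G l) = l \<and> shift (deg G l) y = x)"

text \<open>The conditions of a Lambda-semibranching function system with
  D_l = Z(s l), R_l = Z(l), tau_l = sigma_l, tau^m = sigma^m that depend on the
  measure (the purely set-theoretic conditions hold for the standard maps):
  mu(D_v) > 0 and mu o tau_l << mu on D_l with positive Radon-Nikodym derivative.\<close>

definition comp_prefix_measure ::
  "('a, 'k) kgraph \<Rightarrow> ('a, 'k) ipath measure \<Rightarrow> 'a \<Rightarrow> ('a, 'k) ipath measure" where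
  "comp_prefix_measure G M l =
     measure_of (cyl G (src G l)) (sets (restrict_space M (cyl G (src G l))))
       (\<lambda>A. emeasure M (prefix G l ` A))"

definition std_semibranching :: "('a, 'k) kgraph \<Rightarrow> ('a, 'k) ipath measure \<Rightarrow> bool" where
  "std_semibranching G M \<longleftrightarrow>
     sets M = sets (path_space G) \<and>
     (\<forall>v. vertex G v \<longrightarrow> emeasure M (cyl G v) > 0) \<and>
     (\<forall>l\<in>Mor G.
        absolutely_continuous (restrict_space M (cyl G (src G l))) (comp_prefix_measure G M l) \<and>
        (AE x in restrict_space M (cyl G (src G l)).
           RN_deriv (restrict_space M (cyl G (src G l))) (comp_prefix_measure G M l) x > 0))"

definition pushfwd_prefix ::
  "('a, 'k) kgraph \<Rightarrow> ('a, 'k) ipath measure \<Rightarrow> 'a \<Rightarrow> ('a, 'k) ipath measure" where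
  "pushfwd_prefix G M l = distr (restrict_space M (cyl G (src G l))) M (prefix G l)"

definition std_projective_system ::
  "('a, 'k) kgraph \<Rightarrow> ('a, 'k) ipath measure \<Rightarrow> ('a \<Rightarrow> ('a, 'k) ipath \<Rightarrow> real) \<Rightarrow> bool" where
  "std_projective_system G M f \<longleftrightarrow>
     std_semibranching G M \<and>
     (\<forall>l\<in>Mor G.
        f l \<in> borel_measurable M \<and> integrable M (\<lambda>x. (f l x)\<^sup>2) \<and>
        (AE x in M. ennreal ((f l x)\<^sup>2) = RN_deriv M (pushfwd_prefix G M l) x) \<and>
        (AE x in M. x \<in> cyl G l \<longrightarrow> f l x \<noteq> 0)) \<and>
     (\<forall>l\<in>Mor G. \<forall>n\<in>Mor G. src G l = rng G n \<longrightarrow>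
        (AE x in M. f l x * f n (shift (deg G l) x) = f (cmp G l n) x))"

text \<open>L^2(M) is modelled by square-integrable measurable complex functions;
  all notions below are invariant under a.e. equality.\<close>

definition L2 :: "'b measure \<Rightarrow> ('b \<Rightarrow> complex) set" where
  "L2 M = {g \<in> borel_measurable M. integrable M (\<lambda>x. (cmod (g x))\<^sup>2)}"

definition closed_subspace_L2 :: "'b measure \<Rightarrow> ('b \<Rightarrow> complex) set \<Rightarrow> bool" where
  "closed_subspace_L2 M H \<longleftrightarrow>
     H \<subseteq> L2 M \<and> (\<lambda>x. 0) \<in> H \<and>
     (\<forall>g\<in>H. \<forall>h\<in>H. (\<lambda>x. g x + h x) \<in> H) \<and>
     (\<forall>c. \<forall>g\<in>H. (\<lambda>x. c * g x) \<in> H) \<and>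
     (\<forall>g\<in>H. \<forall>h\<in>L2 M. (AE x in M. g x = h x) \<longrightarrow> h \<in> H) \<and>
     (\<forall>s h. (\<forall>n. s n \<in> H) \<longrightarrow> h \<in> L2 M \<longrightarrow>
        (\<lambda>n. \<integral>x. (cmod (s n x - h x))\<^sup>2 \<partial>M) \<longlonglongrightarrow> 0 \<longrightarrow> h \<in> H)"

definition orth_L2 :: "'b measure \<Rightarrow> ('b \<Rightarrow> complex) set \<Rightarrow> ('b \<Rightarrow> complex) set" where
  "orth_L2 M H = {g \<in> L2 M. \<forall>h\<in>H. (\<integral>x. g x * cnj (h x) \<partial>M) = 0}"

definition Top :: "('a, 'k) kgraph \<Rightarrow> ('a \<Rightarrow> ('a, 'k) ipath \<Rightarrow> real) \<Rightarrow> 'a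
                   \<Rightarrow> (('a, 'k) ipath \<Rightarrow> complex) \<Rightarrow> (('a, 'k) ipath \<Rightarrow> complex)" where
  "Top G f l g = (\<lambda>x. complex_of_real (f l x) * g (shift (deg G l) x))"

text \<open>Subrepresentation of C*(Lambda): a closed subspace reducing all
  generators T_l, i.e. invariant under T_l and T_l^* (equivalently, H and its
  orthogonal complement are T_l-invariant).\<close>
definition subrep :: "('a, 'k) kgraph \<Rightarrow> ('a, 'k) ipath measure \<Rightarrow> ('a \<Rightarrow> ('a, 'k) ipath \<Rightarrow> real)
                      \<Rightarrow> (('a, 'k) ipath \<Rightarrow> complex) set \<Rightarrow> bool" where
  "subrep G M f H \<longleftrightarrow> closed_subspace_L2 M H \<and>
     (\<forall>l\<in>Mor G. \<forall>g\<in>H. Top G f l g \<in> H) \<and>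
     (\<forall>l\<in>Mor G. \<forall>g\<in>orth_L2 M H. Top G f l g \<in> orth_L2 M H)"

definition nonzero_L2 :: "'b measure \<Rightarrow> ('b \<Rightarrow> complex) set \<Rightarrow> bool" where
  "nonzero_L2 M H \<longleftrightarrow> (\<exists>g\<in>H. \<not> (AE x in M. g x = 0))"

definition unit_equiv ::
  "('a, 'k) kgraph \<Rightarrow> ('a, 'k) ipath measure \<Rightarrow> ('a \<Rightarrow> ('a, 'k) ipath \<Rightarrow> real) \<Rightarrow> (('a, 'k) ipath \<Rightarrow> complex) set
   \<Rightarrow> ('a, 'k) ipath measure \<Rightarrow> ('a \<Rightarrow> ('a, 'k) ipath \<Rightarrow> real) \<Rightarrow> (('a, 'k) ipath \<Rightarrow> complex) set \<Rightarrow> bool" where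
  "unit_equiv G M f H M' f' H' \<longleftrightarrow>
     (\<exists>U. (\<forall>g\<in>H. U g \<in> H') \<and>
          (\<forall>g\<in>H. \<forall>h\<in>H. (AE x in M. g x = h x) \<longrightarrow> (AE x in M'. U g x = U h x)) \<and>
          (\<forall>g\<in>H. \<forall>h\<in>H. \<forall>a b. AE x in M'. U (\<lambda>y. a * g y + b * h y) x = a * U g x + b * U h x) \<and>
          (\<forall>g\<in>H. (\<integral>x. (cmod (U g x))\<^sup>2 \<partial>M') = (\<integral>x. (cmod (g x))\<^sup>2 \<partial>M)) \<and>
          (\<forall>h'\<in>H'. \<exists>g\<in>H. AE x in M'. U g x = h' x) \<and>
          (\<forall>l\<in>Mor G. \<forall>g\<in>H. AE x in M'. U (Top G f l g) x = Top G f' l (U g) x))"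

definition reps_disjoint ::
  "('a, 'k) kgraph \<Rightarrow> ('a, 'k) ipath measure \<Rightarrow> ('a \<Rightarrow> ('a, 'k) ipath \<Rightarrow> real)
   \<Rightarrow> ('a, 'k) ipath measure \<Rightarrow> ('a \<Rightarrow> ('a, 'k) ipath \<Rightarrow> real) \<Rightarrow> bool" where
  "reps_disjoint G M f M' f' \<longleftrightarrow>
     \<not> (\<exists>H H'. subrep G M f H \<and> subrep G M' f' H' \<and> nonzero_L2 M H \<and> nonzero_L2 M' H' \<and>
              unit_equiv G M f H M' f' H')"

definition mutually_singular :: "'b measure \<Rightarrow> 'b measure \<Rightarrow> bool" where
  "mutually_singular M M' \<longleftrightarrow>
     (\<exists>A \<in> sets M \<inter> sets M'. emeasure M A = 0 \<and> emeasure M' (space M' - A) = 0)"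

end

theory Submission
  imports Defs
begin

text \<open>
  If a unitary \<open>U\<close> intertwines two subrepresentations, it intertwines the projections
  \<open>T\<^sub>\<lambda> T\<^sub>\<lambda>\<^sup>*\<close>, which are multiplication by the indicators of the cylinders \<open>Z(\<lambda>)\<close>.
  Hence the measures \<open>|g|\<^sup>2 d\<mu>\<close> and \<open>|U g|\<^sup>2 d\<mu>'\<close> agree on cylinders, so they are equal, and they
  vanish when \<open>\<mu>\<close> and \<open>\<mu>'\<close> are mutually singular.

  Conversely, let \<open>A\<close> be the set on which \<open>\<mu>\<close> and \<open>\<mu>'\<close> are equivalent, with \<open>d\<mu> = \<rho> d\<mu>'\<close> there.
  It is shift-invariant up to null sets, so \<open>L\<^sup>2(A, \<mu>)\<close> and \<open>L\<^sup>2(A, \<mu>')\<close> are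
  subrepresentations. Computing the push-forward of \<open>\<mu>\<close> along the prefixing map in two ways gives
  \<open>\<rho> f\<^sub>\<lambda>\<^sup>2 = (\<rho> \<circ> \<sigma>) f'\<^sub>\<lambda>\<^sup>2\<close>; since the weights are non-negative, taking roots shows that
  multiplication by \<open>\<surd>\<rho>\<close> is a unitary equivalence.
\<close>

section \<open>Paths in k-graphs\<close>

text \<open>A unitary equivalence is given only by linearity, preservation of norms, surjectivity
  and commutation with each \<open>T\<close>, so its behaviour towards adjoints has to be recovered;
  this is done by comparing supports on a finite partition into cylinders. The definition of
  \<open>subrep\<close> speaks of the orthogonal complement, whereas cutting a vector along a
  cylinder uses the adjoint of \<open>T\<close>. Passing from one to the other costs the projection
  theorem, hence completeness of \<open>L2\<close>, for functions taken up to null sets. Two facts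
  are hidden in the hypotheses. The measures are finite, so Radon-Nikodym derivatives between them
  make sense. And the squared weights are true densities: \<open>RN_deriv\<close> is the zero
  function when no density exists, a degenerate case excluded because every cylinder has positive
  mass. For several colours, the intersection of two cylinders need not be a cylinder, so measures
  are compared on a smaller generating family.\<close>

locale k_graph =
  fixes G :: "('a, 'k::finite) kgraph"
  assumes is_kgraph: "is_kgraph G"
begin

section \<open>Category laws and unique factorisation\<close>

lemma countable_Mor: "countable (Mor G)"
  and vertex_rng: "l \<in> Mor G \<Longrightarrow> vertex G (rng G l)"
  and vertex_src: "l \<in> Mor G \<Longrightarrow> vertex G (src G l)"
  and src_vertex: "vertex G v \<Longrightarrow> src G v = v"
  and cmp_rng: "l \<in> Mor G \<Longrightarrow> cmp G (rng G l) l = l"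
  and cmp_src: "l \<in> Mor G \<Longrightarrow> cmp G l (src G l) = l"
  using is_kgraph unfolding is_kgraph_def by blast+

lemma rng_vertex: "vertex G v \<Longrightarrow> rng G v = v"
  and vertex_Mor: "vertex G v \<Longrightarrow> v \<in> Mor G"
  by (simp_all add: vertex_def)

lemma rng_Mor: "l \<in> Mor G \<Longrightarrow> rng G l \<in> Mor G"
  and src_Mor: "l \<in> Mor G \<Longrightarrow> src G l \<in> Mor G"
  and rng_rng: "l \<in> Mor G \<Longrightarrow> rng G (rng G l) = rng G l"
  and rng_src: "l \<in> Mor G \<Longrightarrow> rng G (src G l) = src G l"
  and src_rng: "l \<in> Mor G \<Longrightarrow> src G (rng G l) = rng G l"
  and src_src: "l \<in> Mor G \<Longrightarrow> src G (src G l) = src G l"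
  using vertex_rng vertex_src src_vertex rng_vertex vertex_Mor by blast+

lemma cmp_Mor: "\<lbrakk>l \<in> Mor G; n \<in> Mor G; src G l = rng G n\<rbrakk> \<Longrightarrow> cmp G l n \<in> Mor G"
  and rng_cmp: "\<lbrakk>l \<in> Mor G; n \<in> Mor G; src G l = rng G n\<rbrakk> \<Longrightarrow> rng G (cmp G l n) = rng G l"
  and src_cmp: "\<lbrakk>l \<in> Mor G; n \<in> Mor G; src G l = rng G n\<rbrakk> \<Longrightarrow> src G (cmp G l n) = src G n"
  and deg_cmp: "\<lbrakk>l \<in> Mor G; n \<in> Mor G; src G l = rng G n\<rbrakk> \<Longrightarrow> deg G (cmp G l n) = deg G l + deg G n"
  and cmp_assoc: "\<lbrakk>l \<in> Mor G; n \<in> Mor G; m \<in> Mor G; src G l = rng G n; src G n = rng G m\<rbrakk>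
     \<Longrightarrow> cmp G (cmp G l n) m = cmp G l (cmp G n m)"
  using is_kgraph unfolding is_kgraph_def by blast+

lemmas kgraph_simps = rng_Mor src_Mor rng_rng rng_src src_rng src_src cmp_Mor rng_cmp src_cmp deg_cmp

lemma ex1_factorization:
  "\<lbrakk>l \<in> Mor G; deg G l = m + n\<rbrakk> \<Longrightarrow>
    \<exists>!p. fst p \<in> Mor G \<and> snd p \<in> Mor G \<and> src G (fst p) = rng G (snd p) \<and>
              deg G (fst p) = m \<and> deg G (snd p) = n \<and> cmp G (fst p) (snd p) = l"
  using is_kgraph unfolding is_kgraph_def by blast

lemma factorization:
  assumes "l \<in> Mor G" "m \<le> deg G l"
  obtains a b where "a \<in> Mor G" "b \<in> Mor G" "src G a = rng G b" "deg G a = m"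
    "deg G b = deg G l - m" "cmp G a b = l"
proof -
  have "deg G l = m + (deg G l - m)"
    using assms(2) by (auto simp: fun_eq_iff le_fun_def)
  from ex1_factorization[OF assms(1) this] show ?thesis
    using that by blast
qed

lemma cmp_cancel:
  assumes "a \<in> Mor G" "b \<in> Mor G" "src G a = rng G b"
    and "a' \<in> Mor G" "b' \<in> Mor G" "src G a' = rng G b'"
    and "deg G a = deg G a'" "cmp G a b = cmp G a' b'"
  shows "a = a' \<and> b = b'"
proof -
  have "deg G a + deg G b = deg G a' + deg G b'"
    using assms deg_cmp by metis
  hence d: "deg G b = deg G b'" using assms(7) by simp
  from ex1_factorization[OF cmp_Mor[OF assms(1-3)] deg_cmp[OF assms(1-3)]]
  have "(a, b) = (a', b')"
    by (rule ex1E) (use assms d in \<open>metis fst_conv snd_conv\<close>)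
  thus ?thesis by simp
qed

lemma deg_vertex: "vertex G v \<Longrightarrow> deg G v = 0"
proof -
  assume v: "vertex G v"
  have "deg G (cmp G v v) = deg G v + deg G v"
    using v by (intro deg_cmp) (auto simp: rng_vertex vertex_Mor src_vertex)
  moreover have "cmp G v v = v"
    using cmp_rng[of v] v by (simp add: rng_vertex vertex_Mor)
  ultimately show ?thesis by (simp add: fun_eq_iff)
qed

text \<open>\<open>rng G l\<close> followed by \<open>l\<close>, and \<open>l\<close> followed by
  \<open>src G l\<close>, are two factorisations of \<open>l\<close> whose first factor has degree
  0, so uniqueness identifies them.\<close>

lemma vertex_of_deg0:
  assumes "l \<in> Mor G" "deg G l = 0"
  shows "vertex G l" "rng G l = l" "src G l = l"
proof -
  have "rng G l = l \<and> l = src G l"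
    by (rule cmp_cancel) (use assms deg_vertex vertex_rng in \<open>auto simp: kgraph_simps cmp_rng cmp_src\<close>)
  thus "vertex G l" "rng G l = l" "src G l = l"
    using assms by (auto simp: vertex_def)
qed

section \<open>The factors l(p,q) of a morphism\<close>

definition seg :: "'a \<Rightarrow> ('k \<Rightarrow> nat) \<Rightarrow> ('k \<Rightarrow> nat) \<Rightarrow> 'a" where
  "seg l p q = (THE b. b \<in> Mor G \<and> deg G b = q - p \<and>
     (\<exists>a\<in>Mor G. \<exists>c\<in>Mor G. src G a = rng G b \<and> src G b = rng G c \<and> deg G a = p \<and>
        cmp G a (cmp G b c) = l))"

text \<open>Unique factorisation is applied twice, to strip \<open>a\<close> and then to strip
  \<open>c\<close>, so the description in \<open>seg\<close> has a single candidate.\<close>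

lemma seg_eqI:
  assumes "a \<in> Mor G" "b \<in> Mor G" "c \<in> Mor G" "src G a = rng G b" "src G b = rng G c"
    and "deg G a = p" "deg G b = q - p" "cmp G a (cmp G b c) = l"
  shows "seg l p q = b"
  unfolding seg_def
proof (rule the_equality)
  show "b \<in> Mor G \<and> deg G b = q - p \<and>
     (\<exists>a\<in>Mor G. \<exists>c\<in>Mor G. src G a = rng G b \<and> src G b = rng G c \<and> deg G a = p \<and>
        cmp G a (cmp G b c) = l)"
    using assms by blast
next
  fix b'
  assume "b' \<in> Mor G \<and> deg G b' = q - p \<and>
     (\<exists>a\<in>Mor G. \<exists>c\<in>Mor G. src G a = rng G b' \<and> src G b' = rng G c \<and> deg G a = p \<and>
        cmp G a (cmp G b' c) = l)"
  then obtain a' c' where b': "b' \<in> Mor G" "deg G b' = q - p" "a' \<in> Mor G" "c' \<in> Mor G"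
    "src G a' = rng G b'" "src G b' = rng G c'" "deg G a' = p" "cmp G a' (cmp G b' c') = l"
    by blast
  have "a' = a \<and> cmp G b' c' = cmp G b c"
    by (rule cmp_cancel) (use assms b' in \<open>auto simp: kgraph_simps\<close>)
  hence "b' = b \<and> c' = c"
    by (intro cmp_cancel) (use assms b' in auto)
  thus "b' = b" by simp
qed

lemma seg_factors:
  assumes "l \<in> Mor G" "p \<le> q" "q \<le> deg G l"
  obtains a c where "a \<in> Mor G" "seg l p q \<in> Mor G" "c \<in> Mor G" "src G a = rng G (seg l p q)"
    "src G (seg l p q) = rng G c" "deg G a = p" "deg G (seg l p q) = q - p" "deg G c = deg G l - q"
    "cmp G a (cmp G (seg l p q) c) = l"
proof -
  have "p \<le> deg G l" using assms by (rule_tac order_trans)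
  then obtain a d where a: "a \<in> Mor G" "d \<in> Mor G" "src G a = rng G d" "deg G a = p"
    "deg G d = deg G l - p" "cmp G a d = l"
    using factorization[OF assms(1)] by blast
  have "q - p \<le> deg G d"
    using assms a by (auto simp: le_fun_def diff_le_mono)
  then obtain b c where b: "b \<in> Mor G" "c \<in> Mor G" "src G b = rng G c" "deg G b = q - p"
    "deg G c = deg G d - (q - p)" "cmp G b c = d"
    using factorization[OF a(2)] by blast
  have rd: "rng G d = rng G b" using b rng_cmp by blast
  have "seg l p q = b"
    by (rule seg_eqI[of a b c]) (use a b rd in auto)
  moreover have "deg G c = deg G l - q"
    using assms(2,3) by (auto simp: b a fun_eq_iff le_fun_def)
  ultimately show ?thesis
    using that[of a c] a b rd by auto
qed

lemma seg_Mor: "\<lbrakk>l \<in> Mor G; p \<le> q; q \<le> deg G l\<rbrakk> \<Longrightarrow> seg l p q \<in> Mor G"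
  and deg_seg: "\<lbrakk>l \<in> Mor G; p \<le> q; q \<le> deg G l\<rbrakk> \<Longrightarrow> deg G (seg l p q) = q - p"
  by (erule (2) seg_factors, assumption)+

text \<open>If \<open>l\<close> factors as \<open>a b c\<close>, then \<open>l n\<close> factors as
  \<open>a b (c n)\<close>: the middle factor does not notice what is appended. This lets a path be
  assembled from longer and longer morphisms.\<close>

lemma seg_cmp:
  assumes "l \<in> Mor G" "n \<in> Mor G" "src G l = rng G n" "p \<le> q" "q \<le> deg G l"
  shows "seg (cmp G l n) p q = seg l p q"
proof -
  from assms obtain a c where a: "a \<in> Mor G" "seg l p q \<in> Mor G" "c \<in> Mor G" "src G a = rng G (seg l p q)"
    "src G (seg l p q) = rng G c" "deg G a = p" "deg G (seg l p q) = q - p"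
    "cmp G a (cmp G (seg l p q) c) = l"
    by (metis seg_factors)
  have sc: "src G c = rng G n"
    using a assms(3) by (metis src_cmp cmp_Mor rng_cmp)
  show ?thesis
  proof (rule seg_eqI[of a _ "cmp G c n"])
    have "cmp G a (cmp G (seg l p q) (cmp G c n)) = cmp G a (cmp G (cmp G (seg l p q) c) n)"
      using a assms sc by (simp add: cmp_assoc)
    also have "\<dots> = cmp G (cmp G a (cmp G (seg l p q) c)) n"
      using a assms sc by (intro cmp_assoc[symmetric]) (auto simp: kgraph_simps)
    finally show "cmp G a (cmp G (seg l p q) (cmp G c n)) = cmp G l n"
      using a by simp
  qed (use a assms sc in \<open>auto simp: kgraph_simps\<close>)
qed

lemma seg_full:
  assumes "l \<in> Mor G"
  shows "seg l 0 (deg G l) = l"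
proof (rule seg_eqI[of "rng G l" _ "src G l"])
  show "deg G l = deg G l - 0" by (auto simp: fun_eq_iff)
qed (use assms in \<open>auto simp: kgraph_simps cmp_rng cmp_src deg_vertex vertex_rng\<close>)

lemma rng_seg:
  assumes "l \<in> Mor G" "p \<le> q" "q \<le> deg G l"
  shows "rng G (seg l p q) = seg l p p"
proof -
  from assms obtain a c where a: "a \<in> Mor G" "seg l p q \<in> Mor G" "c \<in> Mor G" "src G a = rng G (seg l p q)"
    "src G (seg l p q) = rng G c" "deg G a = p" "deg G (seg l p q) = q - p"
    "cmp G a (cmp G (seg l p q) c) = l"
    by (metis seg_factors)
  have "rng G (cmp G (seg l p q) c) = rng G (seg l p q)" using a by (simp add: rng_cmp)
  hence e: "cmp G (rng G (seg l p q)) (cmp G (seg l p q) c) = cmp G (seg l p q) c"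
    using a cmp_rng[of "cmp G (seg l p q) c"] by (simp add: cmp_Mor)
  show ?thesis
    by (rule sym, rule seg_eqI[of a _ "cmp G (seg l p q) c"])
      (use a e in \<open>auto simp: kgraph_simps deg_vertex vertex_rng fun_eq_iff\<close>)
qed

lemma cmp_seg:
  assumes "l \<in> Mor G" "p \<le> q" "q \<le> t" "t \<le> deg G l"
  shows "src G (seg l p q) = seg l q q" "cmp G (seg l p q) (seg l q t) = seg l p t"
proof -
  have qd: "q \<le> deg G l" and pt: "p \<le> t" using assms by (auto intro: order_trans)
  from assms qd obtain a c where a: "a \<in> Mor G" "seg l p q \<in> Mor G" "c \<in> Mor G" "src G a = rng G (seg l p q)"
    "src G (seg l p q) = rng G c" "deg G a = p" "deg G (seg l p q) = q - p" "deg G c = deg G l - q"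
    "cmp G a (cmp G (seg l p q) c) = l"
    by (metis seg_factors)
  have "t - q \<le> deg G c" using assms by (auto simp: a le_fun_def diff_le_mono)
  then obtain b e where b: "b \<in> Mor G" "e \<in> Mor G" "src G b = rng G e" "deg G b = t - q"
    "cmp G b e = c"
    using factorization[OF a(3)] by blast
  have rc: "rng G c = rng G b" using b rng_cmp by blast
  have apq: "cmp G (cmp G a (seg l p q)) c = l"
    using a by (simp add: cmp_assoc)
  have dpq: "deg G (cmp G a (seg l p q)) = q"
    using a assms by (auto simp: kgraph_simps fun_eq_iff le_fun_def)
  have *: "seg l q t = b"
    by (rule seg_eqI[of "cmp G a (seg l p q)" _ e]) (use a b rc apq dpq in \<open>auto simp: kgraph_simps\<close>)
  have "seg l p t = cmp G (seg l p q) b"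
  proof (rule seg_eqI[of a _ e])
    show "deg G (cmp G (seg l p q) b) = t - p"
      using assms a b rc by (auto simp: kgraph_simps fun_eq_iff le_fun_def)
    show "cmp G a (cmp G (cmp G (seg l p q) b) e) = l"
      using a b rc by (simp add: cmp_assoc)
  qed (use a b rc in \<open>auto simp: kgraph_simps\<close>)
  thus "cmp G (seg l p q) (seg l q t) = seg l p t" using * by simp
  show "src G (seg l p q) = seg l q q"
    using rng_seg[OF assms(1,3,4)] * a(5) rc by simp
qed

section \<open>Infinite paths, shifts and prefixing\<close>

lemma ipath_Mor: "\<lbrakk>x \<in> ipaths G; p \<le> q\<rbrakk> \<Longrightarrow> x p q \<in> Mor G"
  and ipath_deg: "\<lbrakk>x \<in> ipaths G; p \<le> q\<rbrakk> \<Longrightarrow> deg G (x p q) = q - p"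
  and ipath_rng: "\<lbrakk>x \<in> ipaths G; p \<le> q\<rbrakk> \<Longrightarrow> rng G (x p q) = x p p"
  and ipath_src: "\<lbrakk>x \<in> ipaths G; p \<le> q\<rbrakk> \<Longrightarrow> src G (x p q) = x q q"
  and ipath_cmp: "\<lbrakk>x \<in> ipaths G; p \<le> q; q \<le> t\<rbrakk> \<Longrightarrow> cmp G (x p q) (x q t) = x p t"
  and ipath_undefined: "\<lbrakk>x \<in> ipaths G; \<not> p \<le> q\<rbrakk> \<Longrightarrow> x p q = undefined"
  by (simp_all add: ipaths_def)

lemma zero_le_deg: "(0 :: 'k \<Rightarrow> nat) \<le> m"
  by (simp add: le_fun_def)

lemma ipath_deg0: "x \<in> ipaths G \<Longrightarrow> deg G (x 0 m) = m"
  using ipath_deg[of x 0 m] zero_le_deg by (simp add: fun_eq_iff)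

lemma ipath_seg:
  assumes "x \<in> ipaths G" "p \<le> q" "q \<le> t"
  shows "x p q = seg (x 0 t) p q"
proof (rule sym, rule seg_eqI[of "x 0 p" _ "x q t"])
  have "cmp G (x p q) (x q t) = x p t" using assms by (rule ipath_cmp)
  thus "cmp G (x 0 p) (cmp G (x p q) (x q t)) = x 0 t"
    using ipath_cmp[OF assms(1) zero_le_deg, of p t] assms by (auto intro: order_trans)
qed (use assms zero_le_deg in \<open>auto simp: ipath_Mor ipath_deg ipath_deg0 ipath_rng ipath_src\<close>)

lemma shift_initial: "shift m x 0 n = x m (n + m)"
  using zero_le_deg by (simp add: shift_def)

lemma shift_ipaths:
  assumes "x \<in> ipaths G"
  shows "shift m x \<in> ipaths G"
proof -
  have "q + m - (p + m) = q - p" for p q :: "'k \<Rightarrow> nat" by (auto simp: fun_eq_iff)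
  moreover have "p \<le> q \<Longrightarrow> p + m \<le> q + m" for p q :: "'k \<Rightarrow> nat" by (simp add: le_fun_def)
  ultimately show ?thesis
    using assms unfolding ipaths_def shift_def
    by (auto intro: order_trans)
qed

text \<open>Justifies the definite description in \<open>prefix\<close>. The morphisms
  \<open>L t\<close> extend one another as \<open>t\<close> grows, so their segments agree wherever
  they exist and glue to a path; conversely, every admissible path has the \<open>L t\<close> as
  initial segments.\<close>

lemma prefix_ex1:
  assumes l: "l \<in> Mor G" and x: "x \<in> ipaths G" "x 0 0 = src G l"
  shows "\<exists>!y. y \<in> ipaths G \<and> y 0 (deg G l) = l \<and> shift (deg G l) y = x"
proof -
  define L where "L t = cmp G l (x 0 t)" for t
  \<comment> \<open>\<open>L q\<close> has degree \<open>deg G l + q\<close>, so the segment ending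
    at \<open>q\<close> exists; by \<open>stable\<close> any larger index gives the same
    value.\<close>
  define y where "y p q = (if p \<le> q then seg (L q) p q else undefined)" for p q
  have xt: "x 0 t \<in> Mor G" "rng G (x 0 t) = src G l" "src G (x 0 t) = x t t" "deg G (x 0 t) = t" for t
    using x zero_le_deg by (auto simp: ipath_Mor ipath_rng ipath_src ipath_deg0)
  have L: "L t \<in> Mor G" "deg G (L t) = deg G l + t" "src G (L t) = x t t" for t
    unfolding L_def using l xt by (auto simp: kgraph_simps)
  have le: "q \<le> deg G l + t" if "q \<le> t" for q t :: "'k \<Rightarrow> nat"
    using that by (auto simp: le_fun_def trans_le_add2)
  have L_ext: "L t = cmp G (L q) (x q t)" if "q \<le> t" for q t
  proof -
    have "x 0 t = cmp G (x 0 q) (x q t)"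
      using ipath_cmp[OF x(1) zero_le_deg that] by simp
    thus ?thesis unfolding L_def
      using l xt that x by (simp add: cmp_assoc ipath_Mor ipath_rng)
  qed
  have stable: "seg (L t) p q = seg (L s) p q" if "p \<le> q" "q \<le> deg G l + s" "s \<le> t" for p q s t
    unfolding L_ext[OF that(3)]
    by (rule seg_cmp) (use that x L in \<open>auto simp: ipath_Mor ipath_rng\<close>)
  have y_seg: "y p q = seg (L t) p q" if "p \<le> q" "q \<le> t" for p q t
    using stable[of p q q t] that le[of q q] by (simp add: y_def)
  have y_ip: "y \<in> ipaths G"
    unfolding ipaths_def
  proof (intro CollectI conjI allI impI)
    fix p q :: "'k \<Rightarrow> nat" assume "\<not> p \<le> q" thus "y p q = undefined" by (simp add: y_def)
  next
    fix p q :: "'k \<Rightarrow> nat" assume pq: "p \<le> q"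
    have q: "q \<le> deg G (L q)" using le[of q q] L by simp
    show "y p q \<in> Mor G" "deg G (y p q) = q - p"
      using pq L q by (auto simp: y_def seg_Mor deg_seg)
    show "rng G (y p q) = y p p"
      using rng_seg[OF L(1) pq q] y_seg[of p p q] pq by (simp add: y_def)
    show "src G (y p q) = y q q"
      using cmp_seg(1)[OF L(1) pq order_refl q] pq by (simp add: y_def)
  next
    fix p q t :: "'k \<Rightarrow> nat" assume pq: "p \<le> q" "q \<le> t"
    have t: "t \<le> deg G (L t)" using le[of t t] L by simp
    show "cmp G (y p q) (y q t) = y p t"
      using cmp_seg(2)[OF L(1) pq t] y_seg pq by (metis order_refl order_trans)
  qed
  have y0: "y 0 (deg G l) = l"
  proof -
    have "y 0 (deg G l) = seg (cmp G l (x 0 (deg G l))) 0 (deg G l)"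
      using zero_le_deg by (simp add: y_def L_def)
    also have "\<dots> = seg l 0 (deg G l)"
      by (rule seg_cmp) (use l xt zero_le_deg in auto)
    finally show ?thesis using seg_full[OF l] by simp
  qed
  have "shift (deg G l) y p q = x p q" for p q
  proof (cases "p \<le> q")
    case True
    have "y (p + deg G l) (q + deg G l) = seg (L (q + deg G l)) (p + deg G l) (q + deg G l)"
      using True by (auto simp: y_def le_fun_def)
    also have "\<dots> = seg (L q) (p + deg G l) (q + deg G l)"
      by (rule stable) (use True in \<open>auto simp: le_fun_def add.commute\<close>)
    also have "\<dots> = x p q"
    proof (rule seg_eqI[of "L p" _ "x q q"])
      have "cmp G (x p q) (x q q) = x p q"
        using ipath_cmp[OF x(1) True order_refl] .
      thus "cmp G (L p) (cmp G (x p q) (x q q)) = L q"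
        using L_ext[OF True] by simp
      show "deg G (x p q) = q + deg G l - (p + deg G l)"
        using x True by (auto simp: ipath_deg fun_eq_iff)
    qed (use x True L in \<open>auto simp: ipath_Mor ipath_rng ipath_src add.commute\<close>)
    finally show ?thesis using True by (simp add: shift_def)
  next
    case False
    thus ?thesis using x by (simp add: shift_def ipath_undefined)
  qed
  hence ys: "shift (deg G l) y = x" by blast
  \<comment> \<open>The initial segment of \<open>z\<close> of degree \<open>deg G l + q\<close> is
    forced to be \<open>L q\<close>, and it determines \<open>z p q\<close>.\<close>
  have "z = y" if z: "z \<in> ipaths G" "z 0 (deg G l) = l" "shift (deg G l) z = x" for z
  proof (intro ext)
    fix p q
    show "z p q = y p q"
    proof (cases "p \<le> q")
      case True
      have "z 0 (deg G l + q) = cmp G (z 0 (deg G l)) (z (deg G l) (deg G l + q))"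
        by (rule ipath_cmp[symmetric]) (use z zero_le_deg in \<open>auto simp: le_fun_def\<close>)
      also have "\<dots> = cmp G l (x 0 q)"
        using z(2) z(3)[symmetric] zero_le_deg by (simp add: shift_def add.commute)
      finally have "z 0 (deg G l + q) = L q" by (simp add: L_def)
      with ipath_seg[OF z(1) True, of "deg G l + q"] le[of q q] True
      show ?thesis by (simp add: y_def)
    qed (use z in \<open>simp add: y_def ipath_undefined\<close>)
  qed
  with y_ip y0 ys show ?thesis by blast
qed

lemma cyl_iff: "x \<in> cyl G l \<longleftrightarrow> x \<in> ipaths G \<and> x 0 (deg G l) = l"
  by (simp add: cyl_def)

lemma cyl_src_iff: "l \<in> Mor G \<Longrightarrow> x \<in> cyl G (src G l) \<longleftrightarrow> x \<in> ipaths G \<and> x 0 0 = src G l"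
  by (simp add: cyl_def deg_vertex vertex_src)

lemma
  assumes "l \<in> Mor G" "x \<in> cyl G (src G l)"
  shows prefix_cyl: "prefix G l x \<in> cyl G l"
    and shift_prefix: "shift (deg G l) (prefix G l x) = x"
  using theI'[OF prefix_ex1[of l x]] assms(1) assms(2)[unfolded cyl_src_iff[OF assms(1)]]
  unfolding prefix_def[symmetric] by (auto simp: cyl_iff)

lemma shift_cyl:
  assumes "l \<in> Mor G" "x \<in> cyl G l"
  shows "shift (deg G l) x \<in> cyl G (src G l)"
proof -
  have "shift (deg G l) x 0 0 = x (deg G l) (deg G l)"
    by (simp add: shift_def)
  also have "\<dots> = src G (x 0 (deg G l))"
    using ipath_src[of x 0 "deg G l"] assms(2) zero_le_deg by (simp add: cyl_iff)
  finally have "shift (deg G l) x 0 0 = src G (x 0 (deg G l))" .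
  thus ?thesis unfolding cyl_src_iff[OF assms(1)] using assms by (simp add: cyl_iff shift_ipaths)
qed

lemma prefix_shift:
  assumes "l \<in> Mor G" "x \<in> cyl G l"
  shows "prefix G l (shift (deg G l) x) = x"
  using the1_equality[OF prefix_ex1[of l "shift (deg G l) x"], of x]
    shift_cyl[OF assms, unfolded cyl_src_iff[OF assms(1)]] assms
  unfolding prefix_def[symmetric] by (simp add: cyl_iff)

lemma prefix_vertex:
  assumes "vertex G v" "x \<in> cyl G v"
  shows "prefix G v x = x"
proof -
  have "shift (deg G v) x = x"
    using assms by (auto simp: fun_eq_iff shift_def deg_vertex cyl_iff ipath_undefined)
  thus ?thesis using prefix_shift[of v x] assms by (simp add: vertex_Mor)
qed

text \<open>The initial segment of degree \<open>m\<close> is decided by \<open>x 0 m\<close> alone,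
  since \<open>l\<close> followed by \<open>x 0 m\<close> already has degree at least
  \<open>m\<close>. Preimages of cylinders under \<open>prefix\<close> thereby become conditions on
  one initial segment.\<close>

lemma prefix_initial:
  assumes "l \<in> Mor G" "x \<in> cyl G (src G l)"
  shows "prefix G l x 0 m = seg (cmp G l (x 0 m)) 0 m"
proof -
  let ?y = "prefix G l x"
  have y: "?y \<in> ipaths G" "?y 0 (deg G l) = l" using prefix_cyl[OF assms] by (auto simp: cyl_iff)
  have "?y 0 (deg G l + m) = cmp G (?y 0 (deg G l)) (?y (deg G l) (deg G l + m))"
    by (rule ipath_cmp[symmetric]) (use y zero_le_deg in \<open>auto simp: le_fun_def\<close>)
  also have "?y (deg G l) (deg G l + m) = shift (deg G l) ?y 0 m"
    using zero_le_deg by (simp add: shift_def add.commute)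
  finally have "?y 0 (deg G l + m) = cmp G l (x 0 m)"
    by (simp only: y(2) shift_prefix[OF assms])
  thus ?thesis
    using ipath_seg[OF y(1) zero_le_deg, of m "deg G l + m"] by (simp add: le_fun_def)
qed

section \<open>Borel structure of the path space\<close>

lemma cyl_subset: "cyl G l \<subseteq> ipaths G"
  by (auto simp: cyl_def)

lemma space_path_space: "space (path_space G) = ipaths G"
  and sets_path_space: "sets (path_space G) = sigma_sets (ipaths G) (cyl G ` Mor G)"
  unfolding path_space_def using cyl_subset by (auto intro!: space_measure_of sets_measure_of)

lemma cyl_sets: "l \<in> Mor G \<Longrightarrow> cyl G l \<in> sets (path_space G)"
  by (simp add: sets_path_space)

lemma ipath_in_cyl:
  assumes "x \<in> ipaths G"
  shows "x \<in> cyl G (x 0 m)" "x 0 m \<in> {l \<in> Mor G. deg G l = m}"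
  using assms ipath_Mor[OF assms zero_le_deg] by (auto simp: cyl_iff ipath_deg0)

text \<open>No condition on \<open>P\<close> is needed: the set is a union of cylinders indexed by a
  subset of the countable set \<open>Mor G\<close>.\<close>

lemma initial_segment_sets: "{x \<in> ipaths G. P (x 0 m)} \<in> sets (path_space G)"
proof -
  have "{x \<in> ipaths G. P (x 0 m)} = (\<Union>r\<in>{r \<in> Mor G. deg G r = m \<and> P r}. cyl G r)"
    using ipath_in_cyl[of _ m] by (fastforce simp: cyl_iff)
  also have "\<dots> \<in> sets (path_space G)"
    by (intro sets.countable_UN'') (auto intro: cyl_sets countable_subset[OF _ countable_Mor])
  finally show ?thesis .
qed

lemma segment_sets:
  assumes "p \<le> q" shows "{x \<in> ipaths G. P (x p q)} \<in> sets (path_space G)"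
proof -
  have "{x \<in> ipaths G. P (x p q)} = {x \<in> ipaths G. P (seg (x 0 q) p q)}"
    using ipath_seg[OF _ assms order_refl] by metis
  thus ?thesis using initial_segment_sets[of "\<lambda>r. P (seg r p q)" q] by (simp only:)
qed

lemma shift_measurable:
  assumes M: "sets M = sets (path_space G)"
  shows "shift m \<in> measurable M M"
proof (rule measurable_sigma_sets)
  have sp: "space M = ipaths G" using sets_eq_imp_space_eq[OF M] space_path_space by simp
  show "sets M = sigma_sets (ipaths G) (cyl G ` Mor G)" by (simp add: M sets_path_space)
  show "cyl G ` Mor G \<subseteq> Pow (ipaths G)" using cyl_subset by auto
  show "shift m \<in> space M \<rightarrow> ipaths G"
    using shift_ipaths by (auto simp: sp)
  fix A assume "A \<in> cyl G ` Mor G"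
  then obtain l where l: "l \<in> Mor G" "A = cyl G l" by blast
  have "shift m -` A \<inter> space M = {x \<in> ipaths G. x m (deg G l + m) = l}"
    using zero_le_deg shift_ipaths[of _ m] by (auto simp: l cyl_iff sp shift_initial)
  also have "\<dots> \<in> sets M"
    unfolding M by (rule segment_sets) (simp add: le_fun_def)
  finally show "shift m -` A \<inter> space M \<in> sets M" .
qed

lemma prefix_measurable:
  assumes l: "l \<in> Mor G" and M: "sets M = sets (path_space G)"
  shows "prefix G l \<in> measurable (restrict_space M (cyl G (src G l))) M"
proof (rule measurable_sigma_sets)
  have sp: "space M = ipaths G" using sets_eq_imp_space_eq[OF M] space_path_space by simp
  have src: "cyl G (src G l) \<in> sets M" using l by (simp add: M cyl_sets kgraph_simps)
  have spr: "space (restrict_space M (cyl G (src G l))) = cyl G (src G l)"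
    using sp cyl_subset[of "src G l"] by (auto simp: space_restrict_space)
  show "sets M = sigma_sets (ipaths G) (cyl G ` Mor G)" by (simp add: M sets_path_space)
  show "cyl G ` Mor G \<subseteq> Pow (ipaths G)" using cyl_subset by auto
  show "prefix G l \<in> space (restrict_space M (cyl G (src G l))) \<rightarrow> ipaths G"
    using prefix_cyl[OF l] cyl_subset by (auto simp: spr)
  fix A assume "A \<in> cyl G ` Mor G"
  then obtain n where n: "n \<in> Mor G" "A = cyl G n" by blast
  have "prefix G l -` A \<inter> cyl G (src G l)
      = {x \<in> ipaths G. seg (cmp G l (x 0 (deg G n))) 0 (deg G n) = n} \<inter> cyl G (src G l)"
    using prefix_cyl[OF l] prefix_initial[OF l] cyl_subset by (auto simp: n cyl_iff)
  also have "\<dots> \<in> sets (restrict_space M (cyl G (src G l)))"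
    using src M initial_segment_sets[of "\<lambda>r. seg (cmp G l r) 0 (deg G n) = n"]
    by (subst sets_restrict_space_iff) (auto simp: sp cyl_subset Int_absorb2)
  finally show "prefix G l -` A \<inter> space (restrict_space M (cyl G (src G l)))
     \<in> sets (restrict_space M (cyl G (src G l)))" by (simp add: spr)
qed

lemma cyl_disjoint: "\<lbrakk>deg G l = deg G n; l \<noteq> n\<rbrakk> \<Longrightarrow> cyl G l \<inter> cyl G n = {}"
  by (auto simp: cyl_iff)

lemma UN_cyl: "(\<Union>l\<in>{l\<in>Mor G. deg G l = m}. cyl G l) = ipaths G"
  using ipath_in_cyl[of _ m] cyl_subset by fast

text \<open>Cylinders do not form a \<open>\<pi>\<close>-system, but those of constant degree do, up to the
  empty set: any two of them are nested or disjoint.\<close>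

definition diag_cyls :: "('a, 'k) ipath set set" where
  "diag_cyls = insert {} (cyl G ` {l \<in> Mor G. \<exists>n. deg G l = (\<lambda>_. n)})"

lemma diag_cyls_subset: "diag_cyls \<subseteq> Pow (ipaths G)"
  using cyl_subset by (auto simp: diag_cyls_def)

lemma cyl_nested:
  assumes "l \<in> Mor G" "r \<in> Mor G" "deg G l \<le> deg G r" "cyl G l \<inter> cyl G r \<noteq> {}"
  shows "cyl G r \<subseteq> cyl G l"
proof
  fix x assume x: "x \<in> cyl G r"
  from assms(4) obtain y where y: "y \<in> cyl G l" "y \<in> cyl G r" by blast
  show "x \<in> cyl G l"
    using ipath_seg[OF _ zero_le_deg assms(3), of x] ipath_seg[OF _ zero_le_deg assms(3), of y] x y
    by (simp add: cyl_iff)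
qed

lemma Int_stable_diag_cyls: "Int_stable diag_cyls"
proof (rule Int_stableI)
  fix A B assume AB: "A \<in> diag_cyls" "B \<in> diag_cyls"
  show "A \<inter> B \<in> diag_cyls"
  proof (cases "A \<inter> B = {}")
    case False
    then obtain l r n m where lr: "l \<in> Mor G" "r \<in> Mor G" "deg G l = (\<lambda>_. n)" "deg G r = (\<lambda>_. m)"
      "A = cyl G l" "B = cyl G r"
      using AB by (auto simp: diag_cyls_def)
    have "deg G l \<le> deg G r \<or> deg G r \<le> deg G l"
      using lr by (auto simp: le_fun_def)
    hence "A \<inter> B = A \<or> A \<inter> B = B"
      using cyl_nested[of l r] cyl_nested[of r l] lr False by blast
    thus ?thesis using AB by auto
  qed (simp add: diag_cyls_def)
qed

text \<open>A cylinder is the union of the cylinders of its extensions to any larger degree, and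
  some constant degree always lies above a given one. Countability of \<open>Mor G\<close> keeps the
  union inside the sigma-algebra.\<close>

lemma sets_path_space_diag: "sets (path_space G) = sigma_sets (ipaths G) diag_cyls"
proof
  have "cyl G l \<in> sigma_sets (ipaths G) diag_cyls" if l: "l \<in> Mor G" for l
  proof -
    \<comment> \<open>The sum of the coordinates is merely a convenient common bound for
      them.\<close>
    define N where "N = (\<lambda>_::'k. \<Sum>i\<in>UNIV. deg G l i)"
    have le: "deg G l \<le> N" by (auto simp: N_def le_fun_def intro!: member_le_sum)
    let ?F = "{r \<in> Mor G. deg G r = N \<and> seg r 0 (deg G l) = l}"
    have "cyl G l = (\<Union>r\<in>?F. cyl G r)"
    proof (intro equalityI subsetI)
      fix x assume "x \<in> cyl G l"
      hence x: "x \<in> ipaths G" "x 0 (deg G l) = l" by (auto simp: cyl_iff)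
      have "x \<in> cyl G (x 0 N)" using x by (simp add: cyl_iff ipath_deg0)
      moreover have "x 0 N \<in> ?F"
        using x ipath_seg[OF x(1) zero_le_deg le] zero_le_deg by (auto simp: ipath_Mor ipath_deg0)
      ultimately show "x \<in> (\<Union>r\<in>?F. cyl G r)" by blast
    next
      fix x assume "x \<in> (\<Union>r\<in>?F. cyl G r)"
      thus "x \<in> cyl G l"
        using ipath_seg[OF _ zero_le_deg le, of x] by (auto simp: cyl_iff)
    qed
    also have "\<dots> \<in> sigma_sets (ipaths G) diag_cyls"
      by (intro sigma_sets_UNION)
        (auto simp: diag_cyls_def N_def intro: countable_subset[OF _ countable_Mor])
    finally show ?thesis .
  qed
  thus "sets (path_space G) \<subseteq> sigma_sets (ipaths G) diag_cyls"
    unfolding sets_path_space by (intro sigma_sets_mono) auto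
  have "diag_cyls \<subseteq> sigma_sets (ipaths G) (cyl G ` Mor G)"
    by (auto simp: diag_cyls_def sigma_sets.Empty)
  thus "sigma_sets (ipaths G) diag_cyls \<subseteq> sets (path_space G)"
    unfolding sets_path_space by (rule sigma_sets_mono)
qed

end

section \<open>Square-integrable functions\<close>

text \<open>Young's inequality with weight \<open>e\<close>. It replaces the triangle inequality
  while only squared norms are used; the free weight makes the bound sharp in the limit, as the
  minimiser in \<open>L2_projection\<close> requires.\<close>

lemma cmod_add_square_le:
  assumes "e > 0"
  shows "(cmod (a + b))\<^sup>2 \<le> (1 + e) * (cmod a)\<^sup>2 + (1 + 1/e) * (cmod b)\<^sup>2"
proof -
  let ?a = "cmod a" and ?b = "cmod b"
  have "(cmod (a + b))\<^sup>2 \<le> (?a + ?b)\<^sup>2"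
    by (intro power_mono norm_triangle_ineq) simp
  moreover have "0 \<le> (sqrt e * ?a - ?b / sqrt e)\<^sup>2" by simp
  hence "2 * ?a * ?b \<le> e * ?a\<^sup>2 + 1/e * ?b\<^sup>2"
    using assms by (simp add: power2_diff power_mult_distrib power_divide)
  ultimately show ?thesis by (simp add: power2_sum algebra_simps)
qed

lemma measurable_cnj [measurable]: "cnj \<in> borel_measurable borel"
  by (intro borel_measurable_continuous_onI continuous_intros)

lemma L2_measurable: "g \<in> L2 M \<Longrightarrow> g \<in> borel_measurable M"
  and L2_integrable: "g \<in> L2 M \<Longrightarrow> integrable M (\<lambda>x. (cmod (g x))\<^sup>2)"
  by (auto simp: L2_def)

lemma L2_mono:
  assumes "g \<in> L2 M" "h \<in> borel_measurable M" "AE x in M. cmod (h x) \<le> cmod (g x)"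
  shows "h \<in> L2 M"
  unfolding L2_def
proof (intro CollectI conjI)
  show "integrable M (\<lambda>x. (cmod (h x))\<^sup>2)"
    by (rule Bochner_Integration.integrable_bound[OF L2_integrable[OF assms(1)]])
      (use assms in \<open>auto elim!: eventually_mono intro!: power_mono\<close>)
qed fact

lemma L2_add:
  assumes "g \<in> L2 M" "h \<in> L2 M"
  shows "(\<lambda>x. g x + h x) \<in> L2 M"
  unfolding L2_def
proof (intro CollectI conjI)
  have [measurable]: "g \<in> borel_measurable M" "h \<in> borel_measurable M" using assms by (auto simp: L2_def)
  show "(\<lambda>x. g x + h x) \<in> borel_measurable M" by measurable
  show "integrable M (\<lambda>x. (cmod (g x + h x))\<^sup>2)"
  proof (rule Bochner_Integration.integrable_bound)
    show "integrable M (\<lambda>x. (1 + 1) * (cmod (g x))\<^sup>2 + (1 + 1/1) * (cmod (h x))\<^sup>2)"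
      using assms by (intro Bochner_Integration.integrable_add integrable_mult_right L2_integrable)
    show "AE x in M. norm ((cmod (g x + h x))\<^sup>2)
        \<le> norm ((1 + 1) * (cmod (g x))\<^sup>2 + (1 + 1/1) * (cmod (h x))\<^sup>2)"
      using cmod_add_square_le[of 1] by (auto simp del: div_by_1)
  qed measurable
qed

lemma L2_scale: "g \<in> L2 M \<Longrightarrow> (\<lambda>x. c * g x) \<in> L2 M"
  by (auto simp: L2_def norm_mult power_mult_distrib)

lemma L2_diff:
  assumes "g \<in> L2 M" "h \<in> L2 M"
  shows "(\<lambda>x. g x - h x) \<in> L2 M"
  using L2_add[OF assms(1) L2_scale[OF assms(2), of "-1"]] by simp

lemma L2_inner_integrable:
  assumes "g \<in> L2 M" "h \<in> L2 M"
  shows "integrable M (\<lambda>x. g x * cnj (h x))"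
proof (rule Bochner_Integration.integrable_bound)
  have [measurable]: "g \<in> borel_measurable M" "h \<in> borel_measurable M" using assms by (auto simp: L2_def)
  show "(\<lambda>x. g x * cnj (h x)) \<in> borel_measurable M" by measurable
  show "integrable M (\<lambda>x. (cmod (g x))\<^sup>2 + (cmod (h x))\<^sup>2)"
    using assms by (intro Bochner_Integration.integrable_add L2_integrable)
  have "cmod (g x * cnj (h x)) \<le> (cmod (g x))\<^sup>2 + (cmod (h x))\<^sup>2" for x
  proof -
    have "2 * (cmod (g x) * cmod (h x)) \<le> (cmod (g x))\<^sup>2 + (cmod (h x))\<^sup>2"
      using sum_squares_bound[of "cmod (g x)" "cmod (h x)"] by simp
    moreover have "0 \<le> cmod (g x) * cmod (h x)" by simp
    ultimately show ?thesis by (simp only: norm_mult complex_mod_cnj)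
  qed
  thus "AE x in M. norm (g x * cnj (h x)) \<le> norm ((cmod (g x))\<^sup>2 + (cmod (h x))\<^sup>2)"
    by simp
qed

lemma L2_sq_norm_eq_0:
  assumes "g \<in> L2 M" "(\<integral>x. (cmod (g x))\<^sup>2 \<partial>M) = 0"
  shows "AE x in M. g x = 0"
  using integral_nonneg_eq_0_iff_AE[OF L2_integrable[OF assms(1)]] assms(2) by simp

lemma L2_sq_dist_triangle:
  assumes "g \<in> L2 M" "h \<in> L2 M" "e > 0"
  shows "(\<integral>x. (cmod (g x + h x))\<^sup>2 \<partial>M)
    \<le> (1 + e) * (\<integral>x. (cmod (g x))\<^sup>2 \<partial>M) + (1 + 1/e) * (\<integral>x. (cmod (h x))\<^sup>2 \<partial>M)"
proof -
  have "(\<integral>x. (cmod (g x + h x))\<^sup>2 \<partial>M)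
    \<le> (\<integral>x. (1 + e) * (cmod (g x))\<^sup>2 + (1 + 1/e) * (cmod (h x))\<^sup>2 \<partial>M)"
    by (intro integral_mono L2_integrable L2_add assms cmod_add_square_le
        Bochner_Integration.integrable_add integrable_mult_right)
  also have "\<dots> = (1 + e) * (\<integral>x. (cmod (g x))\<^sup>2 \<partial>M) + (1 + 1/e) * (\<integral>x. (cmod (h x))\<^sup>2 \<partial>M)"
    using assms by (subst Bochner_Integration.integral_add)
      (auto intro!: integrable_mult_right L2_integrable)
  finally show ?thesis .
qed

text \<open>The factor \<open>2 ^ n\<close> in \<open>u\<close> is absorbed by the bound
  \<open>(1/4) ^ n\<close>, so the sum of the \<open>u n\<close> has finite integral and is finite
  a.e. The same factor then pays for passing from squares to absolute values.\<close>

lemma L2_fast_Cauchy_AE_convergent: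
  fixes s :: "nat \<Rightarrow> 'b \<Rightarrow> complex"
  assumes s: "\<And>n. s n \<in> L2 M"
    and fast: "\<And>n. (\<integral>x. (cmod (s (Suc n) x - s n x))\<^sup>2 \<partial>M) \<le> (1/4) ^ n"
  shows "AE x in M. convergent (\<lambda>n. s n x)"
proof -
  have [measurable]: "s n \<in> borel_measurable M" for n using s L2_measurable by blast
  define u where "u n x = 2 ^ n * (cmod (s (Suc n) x - s n x))\<^sup>2" for n x
  have u0: "u n x \<ge> 0" for n x by (simp add: u_def)
  have u_int: "(\<integral>\<^sup>+x. ennreal (u n x) \<partial>M) \<le> ennreal ((1/2) ^ n)" for n
  proof -
    have i: "integrable M (u n)" unfolding u_def
      by (intro integrable_mult_right L2_integrable L2_diff s)
    have "(\<integral>\<^sup>+x. ennreal (u n x) \<partial>M) = ennreal (\<integral>x. u n x \<partial>M)"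
      using i by (intro nn_integral_eq_integral) (simp_all add: u0)
    also have "(\<integral>x. u n x \<partial>M) = 2 ^ n * (\<integral>x. (cmod (s (Suc n) x - s n x))\<^sup>2 \<partial>M)"
      unfolding u_def by (rule integral_mult_right_zero)
    also have "\<dots> \<le> 2 ^ n * (1/4) ^ n" using fast[of n] by simp
    also have "\<dots> = (1/2) ^ n" by (simp add: power_mult_distrib[symmetric])
    finally show ?thesis by (simp add: ennreal_leI)
  qed
  have "(\<integral>\<^sup>+x. (\<Sum>n. ennreal (u n x)) \<partial>M) = (\<Sum>n. \<integral>\<^sup>+x. ennreal (u n x) \<partial>M)"
    by (rule nn_integral_suminf) (simp add: u_def)
  also have "\<dots> \<le> (\<Sum>n. ennreal ((1/2) ^ n))"
    by (intro suminf_le u_int) auto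
  also have "\<dots> = ennreal (\<Sum>n. (1/2) ^ n)"
    by (rule suminf_ennreal2) auto
  also have "\<dots> < \<infinity>" by simp
  finally have "AE x in M. (\<Sum>n. ennreal (u n x)) \<noteq> \<infinity>"
    by (intro nn_integral_PInf_AE) (auto simp: u_def)
  thus ?thesis
  proof (rule eventually_mono)
    fix x assume "(\<Sum>n. ennreal (u n x)) \<noteq> \<infinity>"
    hence su: "summable (\<lambda>n. u n x)"
      by (intro summable_suminf_not_top) (auto simp: u_def)
    have "summable (\<lambda>n. s (Suc n) x - s n x)"
    proof (rule summable_comparison_test')
      show "summable (\<lambda>n. u n x + (1/2) ^ n)"
        by (intro summable_add su) auto
      fix n
      \<comment> \<open>The arithmetic-geometric mean inequality with mutually inverse weights
        bounds the increment itself by its weighted square plus a geometric term.\<close>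
      have "2 * (sqrt (2 ^ n) * cmod (s (Suc n) x - s n x)) * sqrt ((1/2) ^ n) \<le>
        (sqrt (2 ^ n) * cmod (s (Suc n) x - s n x))\<^sup>2 + (sqrt ((1/2) ^ n))\<^sup>2"
        by (rule sum_squares_bound)
      also have "2 * (sqrt (2 ^ n) * cmod (s (Suc n) x - s n x)) * sqrt ((1/2) ^ n)
          = 2 * cmod (s (Suc n) x - s n x) * (sqrt (2 ^ n) * sqrt ((1/2) ^ n))"
        by (simp only: mult_ac)
      also have "sqrt (2 ^ n) * sqrt ((1/2) ^ n) = 1"
        by (simp add: real_sqrt_mult[symmetric] power_mult_distrib[symmetric])
      finally have "2 * cmod (s (Suc n) x - s n x) \<le> u n x + (1/2) ^ n"
        by (simp add: u_def power_mult_distrib)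
      thus "norm (s (Suc n) x - s n x) \<le> u n x + (1/2) ^ n"
        using norm_ge_zero[of "s (Suc n) x - s n x"] by linarith
    qed
    hence "convergent (\<lambda>n. \<Sum>i<n. s (Suc i) x - s i x)"
      by (simp add: summable_iff_convergent)
    hence "convergent (\<lambda>n. s n x - s 0 x)"
      by (simp only: sum_lessThan_telescope[of "\<lambda>n. s n x"])
    from convergent_add[OF this convergent_const[of "s 0 x"]]
    show "convergent (\<lambda>n. s n x)" by simp
  qed
qed

lemma L2_complete:
  fixes s :: "nat \<Rightarrow> 'b \<Rightarrow> complex"
  assumes s: "\<And>n. s n \<in> L2 M"
    and cauchy: "\<And>e. e > 0 \<Longrightarrow> \<exists>N. \<forall>m\<ge>N. \<forall>n\<ge>N. (\<integral>x. (cmod (s m x - s n x))\<^sup>2 \<partial>M) \<le> e"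
  shows "\<exists>h\<in>L2 M. (\<lambda>n. \<integral>x. (cmod (s n x - h x))\<^sup>2 \<partial>M) \<longlonglongrightarrow> 0"
proof -
  have sm [measurable]: "s n \<in> borel_measurable M" for n using s L2_measurable by blast
  have "\<exists>N. \<forall>k. \<forall>m\<ge>N k. \<forall>n\<ge>N k. (\<integral>x. (cmod (s m x - s n x))\<^sup>2 \<partial>M) \<le> (1/4) ^ k"
    by (intro choice allI cauchy) simp
  then obtain N where N: "\<And>k m n. m \<ge> N k \<Longrightarrow> n \<ge> N k \<Longrightarrow>
      (\<integral>x. (cmod (s m x - s n x))\<^sup>2 \<partial>M) \<le> (1/4) ^ k"
    by blast
  \<comment> \<open>The sum dominates \<open>N\<close> at \<open>k\<close> and at all earlier
    indices, so \<open>r (Suc k)\<close> is also at least \<open>N k\<close>; the summand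
    \<open>k\<close> makes \<open>r\<close> unbounded.\<close>
  define r where "r k = (\<Sum>i\<le>k. N i) + k" for k
  have rN: "r k \<ge> N k" for k
    using member_le_sum[of k "{..k}" N] by (simp add: r_def trans_le_add1)
  have rS: "r (Suc k) \<ge> N k" for k using rN[of k] by (simp add: r_def)
  have rk: "r k \<ge> k" for k by (simp add: r_def)
  define h where "h x = lim (\<lambda>k. s (r k) x)" for x
  have hm [measurable]: "h \<in> borel_measurable M"
    unfolding h_def by (intro borel_measurable_lim_metric) auto
  have "AE x in M. convergent (\<lambda>k. s (r k) x)"
    by (rule L2_fast_Cauchy_AE_convergent) (use s N rN rS in auto)
  hence conv: "AE x in M. (\<lambda>k. s (r k) x) \<longlonglongrightarrow> h x"
    unfolding h_def by (auto simp: convergent_LIMSEQ_iff)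
  \<comment> \<open>Fatou along the subsequence, in terms of nonnegative integrals because
    integrability involving \<open>h\<close> is not yet known.\<close>
  have fatou: "(\<integral>\<^sup>+x. ennreal ((cmod (s m x - h x))\<^sup>2) \<partial>M) \<le> ennreal e"
    if "e \<ge> 0" "\<And>n. n \<ge> K \<Longrightarrow> (\<integral>x. (cmod (s m x - s n x))\<^sup>2 \<partial>M) \<le> e" for m e K
  proof -
    have "(\<integral>\<^sup>+x. ennreal ((cmod (s m x - h x))\<^sup>2) \<partial>M)
        = (\<integral>\<^sup>+x. liminf (\<lambda>k. ennreal ((cmod (s m x - s (r k) x))\<^sup>2)) \<partial>M)"
    proof (intro nn_integral_cong_AE eventually_mono[OF conv])
      fix x assume "(\<lambda>k. s (r k) x) \<longlonglongrightarrow> h x"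
      hence "(\<lambda>k. ennreal ((cmod (s m x - s (r k) x))\<^sup>2)) \<longlonglongrightarrow> ennreal ((cmod (s m x - h x))\<^sup>2)"
        by (intro tendsto_intros tendsto_ennrealI)
      thus "ennreal ((cmod (s m x - h x))\<^sup>2) = liminf (\<lambda>k. ennreal ((cmod (s m x - s (r k) x))\<^sup>2))"
        by (intro lim_imp_Liminf[symmetric]) auto
    qed
    also have "\<dots> \<le> liminf (\<lambda>k. \<integral>\<^sup>+x. ennreal ((cmod (s m x - s (r k) x))\<^sup>2) \<partial>M)"
      by (rule nn_integral_liminf) measurable
    also have "\<dots> \<le> ennreal e"
    proof (rule Liminf_le)
      show "eventually (\<lambda>k. (\<integral>\<^sup>+x. ennreal ((cmod (s m x - s (r k) x))\<^sup>2) \<partial>M) \<le> ennreal e) sequentially"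
        using eventually_ge_at_top[of K]
      proof (rule eventually_mono)
        fix k assume "k \<ge> K"
        hence "r k \<ge> K" using rk[of k] by linarith
        thus "(\<integral>\<^sup>+x. ennreal ((cmod (s m x - s (r k) x))\<^sup>2) \<partial>M) \<le> ennreal e"
          using that by (subst nn_integral_eq_integral)
            (auto intro!: ennreal_leI L2_integrable L2_diff s)
      qed
    qed simp
    finally show ?thesis .
  qed
  have diff: "(\<lambda>x. s m x - h x) \<in> L2 M" "(\<integral>x. (cmod (s m x - h x))\<^sup>2 \<partial>M) \<le> e"
    if "e \<ge> 0" "\<And>n. n \<ge> K \<Longrightarrow> (\<integral>x. (cmod (s m x - s n x))\<^sup>2 \<partial>M) \<le> e" for m e K
  proof -
    have f: "(\<integral>\<^sup>+x. ennreal ((cmod (s m x - h x))\<^sup>2) \<partial>M) \<le> ennreal e"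
      using fatou that by blast
    hence "(\<integral>\<^sup>+x. ennreal ((cmod (s m x - h x))\<^sup>2) \<partial>M) < \<infinity>"
      using ennreal_less_top[of e] by (simp add: le_less_trans)
    hence i: "integrable M (\<lambda>x. (cmod (s m x - h x))\<^sup>2)"
      by (intro integrableI_bounded) auto
    thus "(\<lambda>x. s m x - h x) \<in> L2 M" by (simp add: L2_def)
    show "(\<integral>x. (cmod (s m x - h x))\<^sup>2 \<partial>M) \<le> e"
      using f nn_integral_eq_integral[OF i] that(1) by (simp add: ennreal_le_iff)
  qed
  have "(\<lambda>x. s (N 0) x - h x) \<in> L2 M"
    by (rule diff(1)[of 1 "N 0"]) (use N[of 0] in auto)
  from L2_diff[OF s[of "N 0"] this] have "h \<in> L2 M" by simp
  moreover have "(\<lambda>n. \<integral>x. (cmod (s n x - h x))\<^sup>2 \<partial>M) \<longlonglongrightarrow> 0"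
  proof (rule LIMSEQ_I)
    fix e :: real assume e: "e > 0"
    then obtain K where K: "\<forall>m\<ge>K. \<forall>n\<ge>K. (\<integral>x. (cmod (s m x - s n x))\<^sup>2 \<partial>M) \<le> e/2"
      using cauchy[of "e/2"] by auto
    have "norm ((\<integral>x. (cmod (s n x - h x))\<^sup>2 \<partial>M) - 0) < e" if "n \<ge> K" for n
    proof -
      have "(\<integral>x. (cmod (s n x - h x))\<^sup>2 \<partial>M) \<le> e/2"
        by (rule diff(2)[of _ K]) (use K e that in auto)
      thus ?thesis using e by simp
    qed
    thus "\<exists>K. \<forall>n\<ge>K. norm ((\<integral>x. (cmod (s n x - h x))\<^sup>2 \<partial>M) - 0) < e" by blast
  qed
  ultimately show ?thesis by blast
qed

section \<open>Orthogonal projection onto a closed subspace\<close>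

lemma L2_parallelogram:
  assumes "g \<in> L2 M" "h \<in> L2 M"
  shows "(\<integral>x. (cmod (g x - h x))\<^sup>2 \<partial>M) + (\<integral>x. (cmod (g x + h x))\<^sup>2 \<partial>M)
    = 2 * (\<integral>x. (cmod (g x))\<^sup>2 \<partial>M) + 2 * (\<integral>x. (cmod (h x))\<^sup>2 \<partial>M)"
proof -
  have "(\<integral>x. (cmod (g x - h x))\<^sup>2 \<partial>M) + (\<integral>x. (cmod (g x + h x))\<^sup>2 \<partial>M)
      = (\<integral>x. (cmod (g x - h x))\<^sup>2 + (cmod (g x + h x))\<^sup>2 \<partial>M)"
    using assms by (intro Bochner_Integration.integral_add[symmetric] L2_integrable L2_add L2_diff)
  also have "\<dots> = (\<integral>x. 2 * (cmod (g x))\<^sup>2 + 2 * (cmod (h x))\<^sup>2 \<partial>M)"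
    by (intro Bochner_Integration.integral_cong refl, simp only: cmod_power2)
      (simp add: power2_eq_square algebra_simps)
  also have "\<dots> = 2 * (\<integral>x. (cmod (g x))\<^sup>2 \<partial>M) + 2 * (\<integral>x. (cmod (h x))\<^sup>2 \<partial>M)"
    using assms by (subst Bochner_Integration.integral_add)
      (auto intro!: integrable_mult_right L2_integrable)
  finally show ?thesis .
qed

lemma L2_sq_norm_diff_scale:
  assumes "g \<in> L2 M" "h \<in> L2 M"
  shows "(\<integral>x. (cmod (g x - c * h x))\<^sup>2 \<partial>M)
    = (\<integral>x. (cmod (g x))\<^sup>2 \<partial>M) - 2 * Re (cnj c * (\<integral>x. g x * cnj (h x) \<partial>M))
      + (cmod c)\<^sup>2 * (\<integral>x. (cmod (h x))\<^sup>2 \<partial>M)"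
proof -
  have ig: "integrable M (\<lambda>x. g x * cnj (h x))" using assms by (rule L2_inner_integrable)
  have i1: "integrable M (\<lambda>x. (cmod (g x))\<^sup>2)" using assms(1) by (rule L2_integrable)
  have i2: "integrable M (\<lambda>x. 2 * Re (cnj c * (g x * cnj (h x))))"
    by (rule integrable_mult_right, rule integrable_Re, rule integrable_mult_right, rule ig)
  have i3: "integrable M (\<lambda>x. (cmod c)\<^sup>2 * (cmod (h x))\<^sup>2)"
    by (rule integrable_mult_right, rule L2_integrable, rule assms(2))
  have "(cmod (g x - c * h x))\<^sup>2 = (cmod (g x))\<^sup>2 - 2 * Re (cnj c * (g x * cnj (h x)))
      + (cmod c)\<^sup>2 * (cmod (h x))\<^sup>2" for x
    by (simp only: cmod_power2) (simp add: power2_eq_square algebra_simps)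
  hence "(\<integral>x. (cmod (g x - c * h x))\<^sup>2 \<partial>M)
      = (\<integral>x. (cmod (g x))\<^sup>2 - 2 * Re (cnj c * (g x * cnj (h x)))
      + (cmod c)\<^sup>2 * (cmod (h x))\<^sup>2 \<partial>M)" by simp
  also have "\<dots> = (\<integral>x. (cmod (g x))\<^sup>2 \<partial>M) - (\<integral>x. 2 * Re (cnj c * (g x * cnj (h x))) \<partial>M)
      + (\<integral>x. (cmod c)\<^sup>2 * (cmod (h x))\<^sup>2 \<partial>M)"
    unfolding Bochner_Integration.integral_add[OF Bochner_Integration.integrable_diff[OF i1 i2] i3]
      Bochner_Integration.integral_diff[OF i1 i2] ..
  also have "(\<integral>x. 2 * Re (cnj c * (g x * cnj (h x))) \<partial>M)
      = 2 * Re (cnj c * (\<integral>x. g x * cnj (h x) \<partial>M))"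
    unfolding integral_mult_right_zero integral_Re[OF integrable_mult_right[OF ig]] ..
  finally show ?thesis by simp
qed

lemma closed_subspace_L2D:
  assumes "closed_subspace_L2 M H"
  shows "g \<in> H \<Longrightarrow> g \<in> L2 M"
    and "(\<lambda>x. 0) \<in> H"
    and "g \<in> H \<Longrightarrow> h \<in> H \<Longrightarrow> (\<lambda>x. g x + h x) \<in> H"
    and "g \<in> H \<Longrightarrow> (\<lambda>x. c * g x) \<in> H"
    and "g \<in> H \<Longrightarrow> h \<in> L2 M \<Longrightarrow> AE x in M. g x = h x \<Longrightarrow> h \<in> H"
    and "(\<And>n. s n \<in> H) \<Longrightarrow> h \<in> L2 M \<Longrightarrow>
        (\<lambda>n. \<integral>x. (cmod (s n x - h x))\<^sup>2 \<partial>M) \<longlonglongrightarrow> 0 \<Longrightarrow> h \<in> H"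
  using assms unfolding closed_subspace_L2_def by blast+

text \<open>The parallelogram law at midpoints makes a minimising sequence Cauchy; its limit lies in
  the closed \<open>H\<close>, and minimality forces the residual to be orthogonal to
  \<open>H\<close>.\<close>

lemma L2_projection:
  assumes H: "closed_subspace_L2 M H" and g: "g \<in> L2 M"
  shows "\<exists>h\<in>H. (\<lambda>x. g x - h x) \<in> orth_L2 M H"
proof -
  note HL = closed_subspace_L2D(1)[OF H] and H0 = closed_subspace_L2D(2)[OF H]
    and Hadd = closed_subspace_L2D(3)[OF H] and Hscale = closed_subspace_L2D(4)[OF H]
    and Hclosed = closed_subspace_L2D(6)[OF H]
  define q where "q h = (\<integral>x. (cmod (g x - h x))\<^sup>2 \<partial>M)" for h
  define I where "I = (INF h\<in>H. q h)"
  have q0: "q h \<ge> 0" for h by (simp add: q_def)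
  have I_le: "I \<le> q h" if "h \<in> H" for h
    unfolding I_def using that q0 by (intro cINF_lower bdd_belowI[of _ 0]) auto
  have I0: "I \<ge> 0" unfolding I_def using H0 q0 by (intro cINF_greatest) auto
  have "\<exists>h\<in>H. q h < I + e" if "e > 0" for e
    using cInf_lessD[of "q ` H" "I + e"] H0 that unfolding I_def by auto
  hence "\<exists>s. \<forall>n. s n \<in> H \<and> q (s n) < I + 1 / (real n + 1)"
    by (intro choice) (simp add: Bex_def)
  then obtain s where s: "\<And>n. s n \<in> H" "\<And>n. q (s n) < I + 1 / (real n + 1)" by blast
  have dist: "(\<integral>x. (cmod (s m x - s n x))\<^sup>2 \<partial>M) \<le> 2 / (real m + 1) + 2 / (real n + 1)" for m n
  proof -
    let ?a = "\<lambda>x. (1/2) * (s m x + s n x)"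
    have "(\<integral>x. (cmod ((g x - s n x) - (g x - s m x)))\<^sup>2 \<partial>M)
        + (\<integral>x. (cmod ((g x - s n x) + (g x - s m x)))\<^sup>2 \<partial>M) = 2 * q (s n) + 2 * q (s m)"
      unfolding q_def by (intro L2_parallelogram L2_diff g HL s)
    moreover have "(\<integral>x. (cmod ((g x - s n x) + (g x - s m x)))\<^sup>2 \<partial>M) = 4 * q ?a"
    proof -
      have "cmod ((g x - s n x) + (g x - s m x)) = 2 * cmod (g x - ?a x)" for x
      proof -
        have "(g x - s n x) + (g x - s m x) = 2 * (g x - ?a x)" by (simp add: algebra_simps)
        thus ?thesis by (simp only: norm_mult) simp
      qed
      thus ?thesis by (simp only: q_def power_mult_distrib) simp
    qed
    moreover have "I \<le> q ?a" by (intro I_le Hscale Hadd s)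
    ultimately have "(\<integral>x. (cmod (s m x - s n x))\<^sup>2 \<partial>M) \<le> 2 * (q (s n) - I) + 2 * (q (s m) - I)"
      by simp
    moreover have "X \<le> 2 * b + 2 * a" if "X \<le> 2 * (c - I) + 2 * (d - I)" "c < I + a" "d < I + b"
      for X a b c d :: real
      using that by argo
    ultimately show ?thesis using s(2)[of n] s(2)[of m] by fastforce
  qed
  have "\<exists>h\<in>L2 M. (\<lambda>n. \<integral>x. (cmod (s n x - h x))\<^sup>2 \<partial>M) \<longlonglongrightarrow> 0"
  proof (rule L2_complete)
    fix e :: real assume e: "e > 0"
    then obtain N :: nat where N: "4 / e < real N" using reals_Archimedean2 by blast
    have "2 / (real m + 1) \<le> e / 2" if "m \<ge> N" for m
    proof -
      have "4 / e \<le> real m + 1" using N that by linarith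
      thus ?thesis using e by (simp add: field_simps)
    qed
    hence "\<forall>m\<ge>N. \<forall>n\<ge>N. (\<integral>x. (cmod (s m x - s n x))\<^sup>2 \<partial>M) \<le> e"
      using dist by (smt (verit) field_sum_of_halves)
    thus "\<exists>N. \<forall>m\<ge>N. \<forall>n\<ge>N. (\<integral>x. (cmod (s m x - s n x))\<^sup>2 \<partial>M) \<le> e" by blast
  qed (use s HL in auto)
  then obtain h where h: "h \<in> L2 M" "(\<lambda>n. \<integral>x. (cmod (s n x - h x))\<^sup>2 \<partial>M) \<longlonglongrightarrow> 0" by blast
  have hH: "h \<in> H" using Hclosed[OF s(1) h] .
  \<comment> \<open>Passing to the limit with the weighted triangle inequality costs a factor
    \<open>1 + e\<close>, which \<open>qI\<close> removes.\<close>
  have qe: "q h \<le> (1 + e) * I" if e: "e > 0" for e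
  proof (rule LIMSEQ_le_const)
    have "(\<lambda>n. (1 + e) * (I + 1 / (real n + 1)) + (1 + 1/e) * (\<integral>x. (cmod (s n x - h x))\<^sup>2 \<partial>M))
        \<longlonglongrightarrow> (1 + e) * (I + 0) + (1 + 1/e) * 0"
      by (intro tendsto_intros h LIMSEQ_inverse_real_of_nat[unfolded inverse_eq_divide of_nat_Suc add.commute[of 1]])
    thus "(\<lambda>n. (1 + e) * (I + 1 / (real n + 1)) + (1 + 1/e) * (\<integral>x. (cmod (s n x - h x))\<^sup>2 \<partial>M))
        \<longlonglongrightarrow> (1 + e) * I" by simp
    have "q h \<le> (1 + e) * (I + 1 / (real n + 1)) + (1 + 1/e) * (\<integral>x. (cmod (s n x - h x))\<^sup>2 \<partial>M)" for n
    proof -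
      have "q h = (\<integral>x. (cmod ((g x - s n x) + (s n x - h x)))\<^sup>2 \<partial>M)" by (simp add: q_def)
      also have "\<dots> \<le> (1 + e) * q (s n) + (1 + 1/e) * (\<integral>x. (cmod (s n x - h x))\<^sup>2 \<partial>M)"
        unfolding q_def using e by (intro L2_sq_dist_triangle L2_diff g h HL s)
      also have "(1 + e) * q (s n) \<le> (1 + e) * (I + 1 / (real n + 1))"
        using s(2)[of n] e by (intro mult_left_mono) auto
      finally show ?thesis by simp
    qed
    thus "\<exists>N. \<forall>n\<ge>N. q h \<le> (1 + e) * (I + 1 / (real n + 1)) + (1 + 1/e) * (\<integral>x. (cmod (s n x - h x))\<^sup>2 \<partial>M)"
      by blast
  qed
  have qI: "q h \<le> I"
  proof (rule field_le_epsilon)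
    fix e :: real assume e: "e > 0"
    \<comment> \<open>Dividing by \<open>I + 1\<close> instead of \<open>I\<close> keeps the choice
      valid when the infimum is 0.\<close>
    have "q h \<le> (1 + e / (I + 1)) * I" using e I0 by (intro qe) auto
    also have "\<dots> = I + e * (I / (I + 1))" by (simp add: algebra_simps)
    also have "\<dots> \<le> I + e * 1"
      using e I0 by (intro add_left_mono mult_left_mono) auto
    finally show "q h \<le> I + e" by simp
  qed
  have "(\<lambda>x. g x - h x) \<in> orth_L2 M H"
    unfolding orth_L2_def
  proof (intro CollectI conjI ballI)
    show gh: "(\<lambda>x. g x - h x) \<in> L2 M" by (intro L2_diff g h)
    fix k assume k: "k \<in> H"
    define c where "c = (\<integral>x. (g x - h x) * cnj (k x) \<partial>M)"
    define K where "K = (\<integral>x. (cmod (k x))\<^sup>2 \<partial>M)"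
    have K0: "K \<ge> 0" by (simp add: K_def)
    \<comment> \<open>Any \<open>t > 0\<close> with \<open>t * K \<le> 1\<close> lets the linear
      term of the variation beat the quadratic one; adding 1 to \<open>K\<close> covers a direction
      \<open>k\<close> of norm 0.\<close>
    define t where "t = 1 / (K + 1)"
    have t: "t > 0" "t * K \<le> 1" using K0 by (auto simp: t_def field_simps)
    have "I \<le> q (\<lambda>x. h x + (complex_of_real t * c) * k x)"
      by (intro I_le Hadd hH Hscale k)
    also have "\<dots> = (\<integral>x. (cmod ((g x - h x) - (complex_of_real t * c) * k x))\<^sup>2 \<partial>M)"
      by (simp add: q_def algebra_simps)
    also have "\<dots> = q h - 2 * Re (cnj (complex_of_real t * c) * c) + (cmod (complex_of_real t * c))\<^sup>2 * K"
      unfolding q_def K_def c_def by (rule L2_sq_norm_diff_scale[OF gh HL[OF k]])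
    also have "Re (cnj (complex_of_real t * c) * c) = t * (cmod c)\<^sup>2"
      by (simp only: cmod_power2) (simp add: power2_eq_square algebra_simps)
    also have "(cmod (complex_of_real t * c))\<^sup>2 = t * (t * (cmod c)\<^sup>2)"
      by (simp add: norm_mult power_mult_distrib power2_eq_square)
    finally have "2 * (t * (cmod c)\<^sup>2) \<le> (t * (cmod c)\<^sup>2) * (t * K)"
      using qI by (simp add: algebra_simps)
    also have "\<dots> \<le> (t * (cmod c)\<^sup>2) * 1"
      using t by (intro mult_left_mono) auto
    finally have "t * (cmod c)\<^sup>2 \<le> 0" by simp
    hence "c = 0" using t(1) by (simp add: mult_le_0_iff)
    thus "(\<integral>x. (g x - h x) * cnj (k x) \<partial>M) = 0" by (simp add: c_def)
  qed
  with hH show ?thesis by blast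
qed

section \<open>Weighted branches\<close>

lemma indicator_L2:
  assumes "g \<in> L2 M" "A \<in> sets M"
  shows "(\<lambda>x. indicator A x * g x) \<in> L2 M"
proof (rule L2_mono[OF assms(1)])
  have [measurable]: "g \<in> borel_measurable M" "A \<in> sets M" using assms L2_measurable by auto
  show "(\<lambda>x. indicator A x * g x) \<in> borel_measurable M" by measurable
qed (auto simp: indicator_def)

text \<open>One generator in isolation: for a morphism \<open>l\<close>, \<open>R\<close> is its
  cylinder, \<open>D\<close> the cylinder of its source, \<open>s\<close> the shift,
  \<open>p\<close> the prefixing map and \<open>w\<close> the weight. The maps are parameters
  separate from the measure, so two measures can be compared on the same branch.\<close>

locale weighted_branch =
  fixes M :: "'b measure" and R D :: "'b set" and s p :: "'b \<Rightarrow> 'b" and w :: "'b \<Rightarrow> real"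
  assumes R_sets [measurable]: "R \<in> sets M" and D_sets [measurable]: "D \<in> sets M"
    and s_measurable [measurable]: "s \<in> measurable M M"
    and p_measurable: "p \<in> measurable (restrict_space M D) M"
    and w_measurable [measurable]: "w \<in> borel_measurable M"
    and p_in: "x \<in> D \<Longrightarrow> p x \<in> R" and s_in: "x \<in> R \<Longrightarrow> s x \<in> D"
    and s_p: "x \<in> D \<Longrightarrow> s (p x) = x" and p_s: "x \<in> R \<Longrightarrow> p (s x) = x"
    and push: "density M (\<lambda>x. ennreal ((w x)\<^sup>2)) = distr (restrict_space M D) M p"
    and w_nonzero: "AE x in M. x \<in> R \<longrightarrow> w x \<noteq> 0"
begin

lemma AE_push_iff:
  assumes "{x \<in> space M. Q x} \<in> sets M"
  shows "(AE x in M. w x \<noteq> 0 \<longrightarrow> Q x) \<longleftrightarrow> (AE x in M. x \<in> D \<longrightarrow> Q (p x))"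
proof -
  have "(AE x in M. w x \<noteq> 0 \<longrightarrow> Q x) \<longleftrightarrow> (AE x in density M (\<lambda>x. ennreal ((w x)\<^sup>2)). Q x)"
    by (subst AE_density) auto
  also have "\<dots> \<longleftrightarrow> (AE x in restrict_space M D. Q (p x))"
    unfolding push using assms by (intro AE_distr_iff p_measurable)
  also have "\<dots> \<longleftrightarrow> (AE x in M. x \<in> D \<longrightarrow> Q (p x))"
    by (intro AE_restrict_space_iff) auto
  finally show ?thesis .
qed

text \<open>The push-forward gives no mass to the complement of \<open>R\<close>, because
  \<open>p\<close> maps \<open>D\<close> into \<open>R\<close>.\<close>

lemma w_zero: "AE x in M. x \<notin> R \<longrightarrow> w x = 0"
proof -
  have "AE x in M. w x \<noteq> 0 \<longrightarrow> x \<in> R"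
    by (subst AE_push_iff) (use p_in in auto)
  thus ?thesis by (auto elim: eventually_mono)
qed

text \<open>Up to null sets \<open>w\<close> is nonzero exactly on \<open>R\<close>, so
  \<open>M\<close> on \<open>R\<close> and the push-forward of \<open>M\<close> on \<open>D\<close>
  have the same null sets. This carries a.e. statements through the branch in both
  directions.\<close>

lemma AE_branch_iff:
  assumes "{x \<in> space M. Q x} \<in> sets M"
  shows "(AE x in M. x \<in> R \<longrightarrow> Q x) \<longleftrightarrow> (AE x in M. x \<in> D \<longrightarrow> Q (p x))"
proof -
  have "(AE x in M. x \<in> R \<longrightarrow> Q x) \<longleftrightarrow> (AE x in M. w x \<noteq> 0 \<longrightarrow> Q x)"
    by (rule eventually_subst) (use w_nonzero w_zero in \<open>eventually_elim, auto\<close>)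
  thus ?thesis using AE_push_iff[OF assms] by simp
qed

lemma measurable_extend_p:
  assumes "u \<in> borel_measurable M"
  shows "(\<lambda>x. if x \<in> D then u (p x) else 0) \<in> borel_measurable M"
  using measurable_comp[OF p_measurable assms]
  by (subst measurable_If_restrict_space_iff) (auto simp: comp_def)

lemma nn_integral_branch:
  assumes [measurable]: "u \<in> borel_measurable M"
  shows "(\<integral>\<^sup>+x. ennreal ((w x)\<^sup>2) * u x \<partial>M) = (\<integral>\<^sup>+x. indicator D x * u (p x) \<partial>M)"
proof -
  have "(\<integral>\<^sup>+x. ennreal ((w x)\<^sup>2) * u x \<partial>M) = (\<integral>\<^sup>+x. u x \<partial>density M (\<lambda>x. ennreal ((w x)\<^sup>2)))"
    by (subst nn_integral_density) auto
  also have "\<dots> = (\<integral>\<^sup>+x. u (p x) \<partial>restrict_space M D)"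
    unfolding push by (intro nn_integral_distr p_measurable) simp
  also have "\<dots> = (\<integral>\<^sup>+x. indicator D x * u (p x) \<partial>M)"
    by (subst nn_integral_restrict_space) (auto simp: mult.commute)
  finally show ?thesis .
qed

lemma integral_branch:
  fixes u :: "'b \<Rightarrow> complex"
  assumes [measurable]: "u \<in> borel_measurable M"
  shows "(\<integral>x. complex_of_real ((w x)\<^sup>2) * u x \<partial>M) = (\<integral>x. indicator D x * u (p x) \<partial>M)"
proof -
  have "(\<integral>x. complex_of_real ((w x)\<^sup>2) * u x \<partial>M) = (\<integral>x. u x \<partial>density M (\<lambda>x. ennreal ((w x)\<^sup>2)))"
    by (subst integral_density) (auto simp: scaleR_conv_of_real)
  also have "\<dots> = (\<integral>x. u (p x) \<partial>restrict_space M D)"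
    unfolding push by (intro integral_distr p_measurable) simp
  also have "\<dots> = (\<integral>x. indicator D x * u (p x) \<partial>M)"
    by (subst integral_restrict_space)
      (auto simp: set_lebesgue_integral_def scaleR_conv_of_real indicator_def intro!: Bochner_Integration.integral_cong)
  finally show ?thesis .
qed

definition T :: "('b \<Rightarrow> complex) \<Rightarrow> 'b \<Rightarrow> complex" where
  "T g = (\<lambda>x. complex_of_real (w x) * g (s x))"

text \<open>\<open>S\<close> is the adjoint of \<open>T\<close>.\<close>

definition S :: "('b \<Rightarrow> complex) \<Rightarrow> 'b \<Rightarrow> complex" where
  "S g = (\<lambda>x. if x \<in> D then g (p x) / complex_of_real (w (p x)) else 0)"

text \<open>By change of variables, the squared norm of \<open>T g\<close> is the integral of the
  squared modulus of \<open>g\<close> over \<open>D\<close>.\<close>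

lemma T_L2:
  assumes "g \<in> L2 M"
  shows "T g \<in> L2 M"
  unfolding L2_def
proof (intro CollectI conjI)
  have [measurable]: "g \<in> borel_measurable M" using assms by (rule L2_measurable)
  show m [measurable]: "T g \<in> borel_measurable M" unfolding T_def by measurable
  have "(\<integral>\<^sup>+x. ennreal ((cmod (T g x))\<^sup>2) \<partial>M) = (\<integral>\<^sup>+x. ennreal ((w x)\<^sup>2) * ennreal ((cmod (g (s x)))\<^sup>2) \<partial>M)"
    by (simp add: T_def norm_mult power_mult_distrib ennreal_mult'')
  also have "\<dots> = (\<integral>\<^sup>+x. indicator D x * ennreal ((cmod (g (s (p x))))\<^sup>2) \<partial>M)"
    by (rule nn_integral_branch) measurable
  also have "\<dots> \<le> (\<integral>\<^sup>+x. ennreal ((cmod (g x))\<^sup>2) \<partial>M)"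
    by (intro nn_integral_mono) (auto simp: indicator_def s_p)
  also have "\<dots> < \<infinity>"
    using L2_integrable[OF assms] by (simp add: nn_integral_eq_integral)
  finally show "integrable M (\<lambda>x. (cmod (T g x))\<^sup>2)"
    by (intro integrableI_bounded) auto
qed

lemma S_L2:
  assumes "g \<in> L2 M"
  shows "S g \<in> L2 M"
  unfolding L2_def
proof (intro CollectI conjI)
  have [measurable]: "g \<in> borel_measurable M" using assms by (rule L2_measurable)
  show m [measurable]: "S g \<in> borel_measurable M"
    unfolding S_def by (rule measurable_extend_p) measurable
  have "(\<integral>\<^sup>+x. ennreal ((cmod (S g x))\<^sup>2) \<partial>M)
      = (\<integral>\<^sup>+x. indicator D x * ennreal ((cmod (g (p x) / complex_of_real (w (p x))))\<^sup>2) \<partial>M)"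
    by (intro nn_integral_cong) (auto simp: S_def indicator_def)
  also have "\<dots> = (\<integral>\<^sup>+x. ennreal ((w x)\<^sup>2) * ennreal ((cmod (g x / complex_of_real (w x)))\<^sup>2) \<partial>M)"
    by (rule nn_integral_branch[symmetric]) measurable
  \<comment> \<open>Only an inequality: where \<open>w x = 0\<close> the quotient is 0 by
    convention.\<close>
  also have "\<dots> \<le> (\<integral>\<^sup>+x. ennreal ((cmod (g x))\<^sup>2) \<partial>M)"
    by (intro nn_integral_mono)
      (auto simp: norm_divide power_divide ennreal_mult''[symmetric] intro!: ennreal_leI)
  also have "\<dots> < \<infinity>"
    using L2_integrable[OF assms] by (simp add: nn_integral_eq_integral)
  finally show "integrable M (\<lambda>x. (cmod (S g x))\<^sup>2)"
    by (intro integrableI_bounded) auto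
qed

lemma adjoint:
  assumes [measurable]: "g \<in> borel_measurable M" "h \<in> borel_measurable M"
  shows "(\<integral>x. T h x * cnj (g x) \<partial>M) = (\<integral>x. h x * cnj (S g x) \<partial>M)"
proof -
  \<comment> \<open>To expose the density, \<open>w\<close> is written as its square divided by
    itself, which is also correct where \<open>w\<close> is 0.\<close>
  have "(\<integral>x. T h x * cnj (g x) \<partial>M)
      = (\<integral>x. complex_of_real ((w x)\<^sup>2) * (h (s x) * cnj (g x) / complex_of_real (w x)) \<partial>M)"
    by (intro Bochner_Integration.integral_cong) (auto simp: T_def power2_eq_square)
  also have "\<dots> = (\<integral>x. indicator D x * (h (s (p x)) * cnj (g (p x)) / complex_of_real (w (p x))) \<partial>M)"
    by (rule integral_branch) measurable
  also have "\<dots> = (\<integral>x. h x * cnj (S g x) \<partial>M)"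
    by (intro Bochner_Integration.integral_cong) (auto simp: S_def indicator_def s_p)
  finally show ?thesis .
qed

lemma T_S: "AE x in M. T (S g) x = indicator R x * g x"
  using w_nonzero w_zero
proof eventually_elim
  case (elim x)
  thus ?case by (cases "x \<in> R") (auto simp: T_def S_def s_in p_s)
qed

text \<open>Turns invariance of \<open>H\<close> and of its complement under \<open>T\<close> into
  invariance of \<open>H\<close> under the adjoint. With \<open>h\<close> the projection of
  \<open>S g\<close>, the residual \<open>k\<close> is orthogonal to \<open>h\<close>, and also to
  \<open>S g\<close> because \<open>T k\<close> is orthogonal to \<open>g\<close>; hence
  \<open>k\<close> is orthogonal to itself.\<close>

lemma reducing_S:
  assumes H: "closed_subspace_L2 M H" and orth: "\<And>g. g \<in> orth_L2 M H \<Longrightarrow> T g \<in> orth_L2 M H"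
    and g: "g \<in> H"
  shows "S g \<in> H"
proof -
  have gL: "g \<in> L2 M" using closed_subspace_L2D(1)[OF H g] .
  have SL: "S g \<in> L2 M" using S_L2[OF gL] .
  obtain h where h: "h \<in> H" "(\<lambda>x. S g x - h x) \<in> orth_L2 M H"
    using L2_projection[OF H SL] by blast
  define k where "k = (\<lambda>x. S g x - h x)"
  have k: "k \<in> orth_L2 M H" "k \<in> L2 M" using h by (auto simp: k_def orth_L2_def)
  have "(\<integral>x. k x * cnj (S g x) \<partial>M) = (\<integral>x. T k x * cnj (g x) \<partial>M)"
    by (rule adjoint[symmetric]) (use gL k L2_measurable in auto)
  also have "\<dots> = 0" using orth[OF k(1)] g by (auto simp: orth_L2_def)
  finally have 1: "(\<integral>x. k x * cnj (S g x) \<partial>M) = 0" .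
  have 2: "(\<integral>x. k x * cnj (h x) \<partial>M) = 0" using k(1) h(1) by (auto simp: orth_L2_def)
  have hL: "h \<in> L2 M" using closed_subspace_L2D(1)[OF H h(1)] .
  have "complex_of_real (\<integral>x. (cmod (k x))\<^sup>2 \<partial>M) = (\<integral>x. k x * cnj (S g x) - k x * cnj (h x) \<partial>M)"
    by (subst integral_complex_of_real[symmetric], intro Bochner_Integration.integral_cong refl,
        simp only: complex_norm_square) (simp add: k_def algebra_simps)
  also have "\<dots> = 0"
    using 1 2 by (subst Bochner_Integration.integral_diff) (auto intro!: L2_inner_integrable k SL hL)
  finally have "AE x in M. k x = 0" using L2_sq_norm_eq_0[OF k(2)] by simp
  hence "AE x in M. h x = S g x" by (auto simp: k_def elim: eventually_mono)
  thus ?thesis using closed_subspace_L2D(5)[OF H h(1) SL] by blast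
qed

text \<open>Off \<open>R\<close> the weight is 0; on \<open>R\<close> invariance puts
  \<open>s x\<close> into \<open>X\<close>, where \<open>g\<close> vanishes up to a null set that
  the branch keeps null. Applied to a set and to its complement, this gives both halves of
  \<open>subrep\<close>.\<close>

lemma T_vanishes_on:
  assumes "g \<in> borel_measurable M" and [measurable]: "X \<in> sets M"
    and g0: "AE x in M. x \<in> X \<longrightarrow> g x = 0"
    and inv: "AE x in M. x \<in> R \<longrightarrow> (s x \<in> X \<longleftrightarrow> x \<in> X)"
  shows "AE x in M. x \<in> X \<longrightarrow> T g x = 0"
proof -
  have [measurable]: "g \<in> borel_measurable M" by fact
  have "AE x in M. x \<in> R \<longrightarrow> (s x \<in> X \<longrightarrow> g (s x) = 0)"
    by (rule AE_branch_iff[THEN iffD2], measurable) (rule eventually_mono[OF g0], auto simp: s_p)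
  with inv w_zero show ?thesis
    by eventually_elim (auto simp: T_def)
qed

end

section \<open>The common part of two measures\<close>

lemma sets_Collect_comp_notin:
  assumes [measurable]: "s \<in> measurable M M" "C \<in> sets M"
  shows "{x \<in> space M. s x \<notin> C} \<in> sets M"
  by measurable

text \<open>Two measures, equivalent on \<open>A\<close>, such that \<open>B\<close> is null for the first and \<open>C\<close> for the second:
  the overlap \<open>A\<close> is invariant because both null ideals are preserved by the branch.\<close>

lemma overlap_invariant:
  assumes M: "weighted_branch M R D s p w" and M': "weighted_branch M' R D s p w'"
    and sets_eq: "sets M' = sets M"
    and ABC: "A \<in> sets M" "B \<in> sets M" "C \<in> sets M" "space M \<subseteq> A \<union> B \<union> C" "A \<inter> C = {}"
    and B: "AE x in M. x \<notin> B" and C: "AE x in M'. x \<notin> C"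
    and transfer: "\<And>Q. (AE x in M. x \<in> A \<longrightarrow> Q x) \<longleftrightarrow> (AE x in M'. x \<in> A \<longrightarrow> Q x)"
  shows "AE x in M. x \<in> R \<longrightarrow> (s x \<in> A \<longleftrightarrow> x \<in> A)"
proof -
  interpret M: weighted_branch M R D s p w by fact
  interpret M': weighted_branch M' R D s p w' by fact
  have C': "C \<in> sets M'" using ABC sets_eq by simp
  \<comment> \<open>Since \<open>A\<close>, \<open>B\<close>, \<open>C\<close> cover the space, it
    suffices that \<open>s x\<close> avoids \<open>B\<close> and \<open>C\<close> when
    \<open>x\<close> is in \<open>A\<close>, and that \<open>x\<close> avoids them when
    \<open>s x\<close> is in \<open>A\<close>. The claims about \<open>B\<close> hold for
    \<open>M\<close> directly; those about \<open>C\<close> are proved for \<open>M'\<close> and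
    moved across \<open>A\<close>.\<close>
  have "AE x in M. x \<in> R \<longrightarrow> s x \<notin> B"
    by (rule M.AE_branch_iff[THEN iffD2, OF sets_Collect_comp_notin[OF M.s_measurable ABC(2)]])
      (rule eventually_mono[OF B], auto simp: M.s_p)
  moreover have "AE x in M'. x \<in> R \<longrightarrow> s x \<notin> C"
    by (rule M'.AE_branch_iff[THEN iffD2, OF sets_Collect_comp_notin[OF M'.s_measurable C']])
      (rule eventually_mono[OF C], auto simp: M.s_p)
  hence "AE x in M'. x \<in> A \<longrightarrow> (x \<in> R \<longrightarrow> s x \<notin> C)" by eventually_elim auto
  hence "AE x in M. x \<in> A \<longrightarrow> (x \<in> R \<longrightarrow> s x \<notin> C)" by (simp only: transfer)
  \<comment> \<open>In the converse direction the point known to lie in \<open>A\<close> is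
    \<open>s x\<close>. So \<open>transfer\<close> is applied on the \<open>D\<close> side, and the
    branch for \<open>M\<close> carries the result to \<open>R\<close>.\<close>
  moreover have "AE x in M'. x \<in> D \<longrightarrow> p x \<notin> C"
    by (rule M'.AE_branch_iff[THEN iffD1, OF sets_Collect_comp_notin[OF measurable_ident C', unfolded id_def]])
      (rule eventually_mono[OF C], auto)
  hence "AE x in M'. x \<in> A \<longrightarrow> (x \<in> D \<longrightarrow> p x \<notin> C)" by eventually_elim auto
  hence AC: "AE x in M. x \<in> A \<longrightarrow> (x \<in> D \<longrightarrow> p x \<notin> C)" by (simp only: transfer)
  have "{x \<in> space M. s x \<in> A \<longrightarrow> x \<notin> C} \<in> sets M"
    using ABC M.s_measurable by measurable
  hence "AE x in M. x \<in> R \<longrightarrow> s x \<in> A \<longrightarrow> x \<notin> C"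
    by (rule M.AE_branch_iff[THEN iffD2]) (rule eventually_mono[OF AC], auto simp: M.s_p)
  ultimately show ?thesis using B AE_space
  proof eventually_elim
    case (elim x)
    have "s x \<in> space M" using elim(5) measurable_space[OF M.s_measurable] by blast
    thus ?case using elim ABC by blast
  qed
qed

text \<open>Both sides are \<open>M'\<close>-densities of one measure, the push-forward along
  \<open>p\<close> of \<open>M\<close> restricted to \<open>A\<close>. The conversion
  \<open>dens\<close> is available only on \<open>A\<close>; invariance moves the indicator of
  \<open>A\<close> between \<open>p x\<close> and \<open>x\<close>, so the conversion can be made at
  either end of the branch. Finiteness of \<open>M'\<close> gives uniqueness of densities.\<close>

lemma branch_cocycle:
  assumes M: "weighted_branch M R D s p w" and M': "weighted_branch M' R D s p w'"
    and sets_eq: "sets M' = sets M" and fin: "finite_measure M'"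
    and A [measurable]: "A \<in> sets M" and rho_M [measurable]: "rho \<in> borel_measurable M"
    and rho_pos: "\<And>x. rho x > (0::real)"
    and dens: "density M (indicator A) = density M' (\<lambda>x. indicator A x * ennreal (rho x))"
    and inv: "AE x in M. x \<in> R \<longrightarrow> (s x \<in> A \<longleftrightarrow> x \<in> A)"
    and inv': "AE x in M'. x \<in> R \<longrightarrow> (s x \<in> A \<longleftrightarrow> x \<in> A)"
  shows "AE x in M'. x \<in> A \<longrightarrow> rho x * (w x)\<^sup>2 = rho (s x) * (w' x)\<^sup>2"
proof -
  interpret M: weighted_branch M R D s p w by fact
  interpret M': weighted_branch M' R D s p w' by fact
  interpret fin: finite_measure M' by fact
  have [measurable]: "A \<in> sets M'" "rho \<in> borel_measurable M'" "w \<in> borel_measurable M'"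
    by (simp_all add: measurable_cong_sets[OF sets_eq refl] sets_eq)
  have tr: "(\<integral>\<^sup>+x. indicator A x * u x \<partial>M) = (\<integral>\<^sup>+x. indicator A x * ennreal (rho x) * u x \<partial>M')"
    if [measurable]: "u \<in> borel_measurable M" for u
  proof -
    have [measurable]: "u \<in> borel_measurable M'" by (simp add: measurable_cong_sets[OF sets_eq refl])
    show ?thesis
      using arg_cong[OF dens, of "\<lambda>N. nn_integral N u"] by (simp add: nn_integral_density)
  qed
  have invD: "AE x in M. x \<in> D \<longrightarrow> (x \<in> A \<longleftrightarrow> p x \<in> A)"
  proof -
    have "{x \<in> space M. s x \<in> A \<longleftrightarrow> x \<in> A} \<in> sets M" by measurable
    hence "AE x in M. x \<in> D \<longrightarrow> (s (p x) \<in> A \<longleftrightarrow> p x \<in> A)"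
      by (rule M.AE_branch_iff[THEN iffD1, OF _ inv])
    thus ?thesis by eventually_elim (auto simp: M.s_p)
  qed
  have invD': "AE x in M'. x \<in> D \<longrightarrow> (x \<in> A \<longleftrightarrow> p x \<in> A)"
  proof -
    have "{x \<in> space M'. s x \<in> A \<longleftrightarrow> x \<in> A} \<in> sets M'" by measurable
    hence "AE x in M'. x \<in> D \<longrightarrow> (s (p x) \<in> A \<longleftrightarrow> p x \<in> A)"
      by (rule M'.AE_branch_iff[THEN iffD1, OF _ inv'])
    thus ?thesis by eventually_elim (auto simp: M.s_p)
  qed
  let ?a = "\<lambda>x. indicator A x * ennreal (rho x) * ennreal ((w x)\<^sup>2)"
  let ?b = "\<lambda>x. ennreal ((w' x)\<^sup>2) * (indicator A x * ennreal (rho (s x)))"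
  have "density M' ?a = density M' ?b"
  proof (rule measure_eqI)
    fix E assume "E \<in> sets (density M' ?a)"
    hence [measurable]: "E \<in> sets M'" "E \<in> sets M" using sets_eq by auto
    have mD: "(\<lambda>x. indicator D x * indicator E (p x) :: ennreal) \<in> borel_measurable M"
    proof -
      have "(\<lambda>x. if x \<in> D then indicator E (p x) else (0::ennreal)) \<in> borel_measurable M"
        by (rule M.measurable_extend_p) measurable
      also have "(\<lambda>x. if x \<in> D then indicator E (p x) else (0::ennreal)) = (\<lambda>x. indicator D x * indicator E (p x))"
        by (auto simp: indicator_def)
      finally show ?thesis .
    qed
    have "emeasure (density M' ?a) E = (\<integral>\<^sup>+x. indicator A x * ennreal (rho x) * (ennreal ((w x)\<^sup>2) * indicator E x) \<partial>M')"
      by (subst emeasure_density) (auto simp: mult_ac)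
    also have "\<dots> = (\<integral>\<^sup>+x. indicator A x * (ennreal ((w x)\<^sup>2) * indicator E x) \<partial>M)"
      by (rule tr[symmetric]) measurable
    also have "\<dots> = (\<integral>\<^sup>+x. ennreal ((w x)\<^sup>2) * (indicator A x * indicator E x) \<partial>M)"
      by (simp add: mult_ac)
    also have "\<dots> = (\<integral>\<^sup>+x. indicator D x * (indicator A (p x) * indicator E (p x)) \<partial>M)"
      by (rule M.nn_integral_branch) measurable
    also have "\<dots> = (\<integral>\<^sup>+x. indicator A x * (indicator D x * indicator E (p x)) \<partial>M)"
      by (intro nn_integral_cong_AE eventually_mono[OF invD]) (auto simp: indicator_def)
    also have "\<dots> = (\<integral>\<^sup>+x. indicator A x * ennreal (rho x) * (indicator D x * indicator E (p x)) \<partial>M')"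
      by (rule tr[OF mD])
    also have "\<dots> = (\<integral>\<^sup>+x. indicator D x * (indicator A (p x) * ennreal (rho (s (p x))) * indicator E (p x)) \<partial>M')"
      by (intro nn_integral_cong_AE eventually_mono[OF invD']) (auto simp: indicator_def M.s_p)
    also have "\<dots> = (\<integral>\<^sup>+x. ennreal ((w' x)\<^sup>2) * (indicator A x * ennreal (rho (s x)) * indicator E x) \<partial>M')"
      by (rule M'.nn_integral_branch[symmetric]) measurable
    also have "\<dots> = emeasure (density M' ?b) E"
      by (subst emeasure_density) (auto simp: mult_ac)
    finally show "emeasure (density M' ?a) E = emeasure (density M' ?b) E" .
  qed simp
  hence "AE x in M'. ?a x = ?b x"
    by (subst (asm) fin.density_unique_iff) measurable
  thus ?thesis
  proof (rule eventually_mono, intro impI)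
    fix x assume "?a x = ?b x" "x \<in> A"
    hence "ennreal (rho x * (w x)\<^sup>2) = ennreal (rho (s x) * (w' x)\<^sup>2)"
      using rho_pos[of x] rho_pos[of "s x"] by (simp add: ennreal_mult'' mult.commute less_imp_le)
    thus "rho x * (w x)\<^sup>2 = rho (s x) * (w' x)\<^sup>2"
      using rho_pos[of x] rho_pos[of "s x"] by (subst (asm) ennreal_inj) (auto simp: less_imp_le)
  qed
qed

text \<open>Lebesgue decomposition in symmetric form, read off from the derivatives \<open>h\<close>
  and \<open>h'\<close> with respect to the sum of the two measures; \<open>rho\<close> is their
  quotient.\<close>

lemma Lebesgue_overlap:
  fixes M M' :: "'b measure"
  assumes "finite_measure M" "finite_measure M'" and sets_eq: "sets M' = sets M"
  obtains A B C rho where "A \<in> sets M" "B \<in> sets M" "C \<in> sets M" "A \<inter> B = {}" "A \<inter> C = {}"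
    "space M \<subseteq> A \<union> B \<union> C" "AE x in M. x \<notin> B" "AE x in M'. x \<notin> C"
    "rho \<in> borel_measurable M" "\<And>x. rho x > (0::real)"
    "density M (indicator A) = density M' (\<lambda>x. indicator A x * ennreal (rho x))"
proof -
  interpret M: finite_measure M by fact
  interpret M': finite_measure M' by fact
  define S where "S = measure_of (space M) (sets M) (\<lambda>X. emeasure M X + emeasure M' X)"
  have space_S: "space S = space M" and sets_S [measurable_cong]: "sets S = sets M" by (auto simp: S_def)
  have sp': "space M' = space M" using sets_eq by (rule sets_eq_imp_space_eq)
  have em_S: "emeasure S X = emeasure M X + emeasure M' X" if "X \<in> sets M" for X
  proof (rule emeasure_measure_of[OF S_def])
    show "sets M \<subseteq> Pow (space M)" by (rule sets.space_closed)
    show "positive (sets S) (\<lambda>X. emeasure M X + emeasure M' X)" by (simp add: positive_def)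
    show "countably_additive (sets S) (\<lambda>X. emeasure M X + emeasure M' X)"
    proof (rule countably_additiveI)
      fix F :: "nat \<Rightarrow> 'b set" assume F: "range F \<subseteq> sets S" "disjoint_family F" "(\<Union>i. F i) \<in> sets S"
      have "(\<Sum>i. emeasure M (F i) + emeasure M' (F i)) = (\<Sum>i. emeasure M (F i)) + (\<Sum>i. emeasure M' (F i))"
        by (intro suminf_add[symmetric]) auto
      also have "\<dots> = emeasure M (\<Union>i. F i) + emeasure M' (\<Union>i. F i)"
        using F sets_S sets_eq by (simp add: suminf_emeasure)
      finally show "(\<Sum>i. emeasure M (F i) + emeasure M' (F i)) = emeasure M (\<Union>i. F i) + emeasure M' (\<Union>i. F i)" .
    qed
  qed (use that sets_S in auto)
  interpret S: finite_measure S
    by (rule finite_measureI) (use em_S[of "space M"] M'.emeasure_finite[of "space M'"] in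
        \<open>auto simp: space_S sp' ennreal_add_eq_top\<close>)
  have "absolutely_continuous S M" "absolutely_continuous S M'"
    using em_S sets_eq by (auto simp: absolutely_continuous_def null_sets_def sets_S)
  then obtain h h' where h [measurable]: "h \<in> borel_measurable S" "h' \<in> borel_measurable S"
    and dM: "density S h = M" and dM': "density S h' = M'"
    using S.Radon_Nikodym_finite_measure[of M] S.Radon_Nikodym_finite_measure[of M']
      assms sets_S by metis
  have "(\<integral>\<^sup>+x. h x \<partial>S) = emeasure (density S h) (space S)"
    by (subst emeasure_density) (auto intro!: nn_integral_cong)
  hence fin: "AE x in S. h x \<noteq> \<infinity>"
    using M.emeasure_finite dM by (intro nn_integral_PInf_AE) auto
  have "(\<integral>\<^sup>+x. h' x \<partial>S) = emeasure (density S h') (space S)"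
    by (subst emeasure_density) (auto intro!: nn_integral_cong)
  hence fin': "AE x in S. h' x \<noteq> \<infinity>"
    using M'.emeasure_finite dM' by (intro nn_integral_PInf_AE) auto
  define A where "A = {x \<in> space S. h x \<noteq> 0 \<and> h x \<noteq> \<infinity> \<and> h' x \<noteq> 0 \<and> h' x \<noteq> \<infinity>}"
  define B where "B = {x \<in> space S. h x = 0}"
  \<comment> \<open>These are the points outside \<open>B\<close> where \<open>h'\<close> is 0 or
    one of the derivatives is infinite; the infinite values occur only on an \<open>S\<close>-null
    set.\<close>
  define C where "C = space S - (A \<union> B)"
  \<comment> \<open>The value 1 off \<open>A\<close> makes \<open>rho\<close> positive everywhere,
    so positivity never carries a side condition.\<close>
  define rho where "rho x = (if x \<in> A then enn2real (h x / h' x) else 1)" for x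
  have A_S [measurable]: "A \<in> sets S" and B_S [measurable]: "B \<in> sets S" by (auto simp: A_def B_def)
  have rho_S [measurable]: "rho \<in> borel_measurable S" unfolding rho_def by measurable
  have rho: "rho x > 0" "x \<in> A \<Longrightarrow> h' x * ennreal (rho x) = h x" for x
  proof -
    have *: "h x / h' x \<noteq> 0" "h x / h' x \<noteq> \<top>" if "x \<in> A"
      using that by (auto simp: A_def ennreal_divide_eq_0_iff ennreal_divide_eq_top_iff)
    thus "rho x > 0" by (auto simp: rho_def enn2real_positive_iff zero_less_iff_neq_zero less_top)
    assume x: "x \<in> A"
    hence "h' x * ennreal (rho x) = h' x * (h x / h' x)" using * by (simp add: rho_def less_top)
    also have "\<dots> = h x"
      using x by (simp add: A_def ennreal_times_divide mult.commute[of "h' x"] mult_divide_eq_ennreal)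
    finally show "h' x * ennreal (rho x) = h x" .
  qed
  show ?thesis
  proof (rule that[of A B C rho])
    show "A \<in> sets M" "B \<in> sets M" "C \<in> sets M"
      using A_S B_S sets_S sets.top[of M] by (auto simp: C_def space_S)
    show "A \<inter> B = {}" "A \<inter> C = {}" "space M \<subseteq> A \<union> B \<union> C"
      by (auto simp: A_def B_def C_def space_S)
    have "AE x in density S h. x \<notin> B" by (subst AE_density) (auto simp: B_def)
    thus "AE x in M. x \<notin> B" by (simp only: dM)
    have "AE x in density S h'. x \<notin> C"
      using fin fin' by (subst AE_density) (auto simp: A_def B_def C_def zero_less_iff_neq_zero elim!: eventually_elim2)
    thus "AE x in M'. x \<notin> C" by (simp only: dM')
    show "rho \<in> borel_measurable M" using rho_S measurable_cong_sets[OF sets_S refl] by blast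
    show "rho x > 0" for x by (rule rho)
    have "density M (indicator A) = density S (\<lambda>x. h x * indicator A x)"
      by (subst dM[symmetric], subst density_density_eq) auto
    also have "\<dots> = density S (\<lambda>x. h' x * (indicator A x * ennreal (rho x)))"
      by (intro density_cong AE_I2) (auto simp: indicator_def rho)
    also have "\<dots> = density M' (\<lambda>x. indicator A x * ennreal (rho x))"
      by (subst dM'[symmetric], subst density_density_eq) auto
    finally show "density M (indicator A) = density M' (\<lambda>x. indicator A x * ennreal (rho x))" .
  qed
qed

section \<open>Disjointness and singularity\<close>

context k_graph
begin

section \<open>Projective systems as families of weighted branches\<close>

lemma space_eq: "sets M = sets (path_space G) \<Longrightarrow> space M = ipaths G"
  using sets_eq_imp_space_eq space_path_space by metis

lemma pushfwd_prefix_vertex: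
  assumes M: "sets M = sets (path_space G)" and v: "vertex G v"
  shows "pushfwd_prefix G M v = density M (indicator (cyl G v))"
proof (rule measure_eqI)
  have vM: "v \<in> Mor G" "src G v = v" using v by (auto simp: vertex_Mor src_vertex)
  have Z: "cyl G v \<in> sets M" using vM cyl_sets M by simp
  have sp: "space (restrict_space M (cyl G v)) = cyl G v"
    using sets.sets_into_space[OF Z] by (auto simp: space_restrict_space)
  fix A assume "A \<in> sets (pushfwd_prefix G M v)"
  hence A: "A \<in> sets M" by (simp add: pushfwd_prefix_def)
  have "prefix G v -` A \<inter> cyl G v = A \<inter> cyl G v" using prefix_vertex[OF v] by auto
  hence "emeasure (pushfwd_prefix G M v) A = emeasure M (A \<inter> cyl G v)"
    using prefix_measurable[OF vM(1) M] A Z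
    by (simp add: pushfwd_prefix_def vM emeasure_distr sp emeasure_restrict_space)
  also have "\<dots> = emeasure (density M (indicator (cyl G v))) A"
    using A Z by (simp add: emeasure_restricted Int_commute)
  finally show "emeasure (pushfwd_prefix G M v) A = emeasure (density M (indicator (cyl G v))) A" .
qed (simp add: pushfwd_prefix_def)

text \<open>Prefixing by a vertex is the identity, so the integral of its squared weight is the mass
  of its cylinder. There are finitely many vertices, and their cylinders cover the space.\<close>

lemma projective_finite_measure:
  assumes fin: "finite_kgraph G" and P: "std_projective_system G M f"
  shows "finite_measure M"
proof
  have M: "sets M = sets (path_space G)"
    using P by (simp add: std_projective_system_def std_semibranching_def)
  have "emeasure M (cyl G v) < \<infinity>" if v: "vertex G v" for v
  proof -
    have vM: "v \<in> Mor G" using v by (rule vertex_Mor)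
    have Z: "cyl G v \<in> sets M" using vM cyl_sets M by simp
    have i: "integrable M (\<lambda>x. (f v x)\<^sup>2)"
      and e: "AE x in M. ennreal ((f v x)\<^sup>2) = RN_deriv M (pushfwd_prefix G M v) x"
      using P vM by (auto simp: std_projective_system_def)
    \<comment> \<open>\<open>RN_deriv\<close> has its defining property only once some density is
      exhibited; here it is the indicator of the cylinder.\<close>
    have "density M (RN_deriv M (pushfwd_prefix G M v)) = pushfwd_prefix G M v"
      by (rule RN_derivI[of "indicator (cyl G v)"]) (use Z pushfwd_prefix_vertex[OF M v] in auto)
    hence "emeasure (density M (indicator (cyl G v))) (space M)
        = emeasure (density M (RN_deriv M (pushfwd_prefix G M v))) (space M)"
      using pushfwd_prefix_vertex[OF M v] by simp
    also have "\<dots> = (\<integral>\<^sup>+x. RN_deriv M (pushfwd_prefix G M v) x \<partial>M)"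
      by (subst emeasure_density) (auto intro!: nn_integral_cong)
    also have "\<dots> = (\<integral>\<^sup>+x. ennreal ((f v x)\<^sup>2) \<partial>M)"
      using e by (intro nn_integral_cong_AE) auto
    also have "\<dots> < \<infinity>" using i by (simp add: nn_integral_eq_integral)
    also have "emeasure (density M (indicator (cyl G v))) (space M) = emeasure M (cyl G v)"
      using Z by (simp add: emeasure_density)
    finally show ?thesis .
  qed
  moreover have "{l \<in> Mor G. deg G l = 0} \<subseteq> {v. vertex G v}" using vertex_of_deg0 by auto
  moreover have f0: "finite {l \<in> Mor G. deg G l = 0}" using fin by (simp add: finite_kgraph_def)
  ultimately have "(\<Sum>l\<in>{l \<in> Mor G. deg G l = 0}. emeasure M (cyl G l)) < \<infinity>"
    by (auto simp: less_top)
  moreover have "emeasure M (space M) \<le> (\<Sum>l\<in>{l \<in> Mor G. deg G l = 0}. emeasure M (cyl G l))"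
    unfolding space_eq[OF M] UN_cyl[of 0, symmetric]
    by (rule emeasure_subadditive_finite[OF f0]) (use cyl_sets M in auto)
  ultimately show "emeasure M (space M) \<noteq> \<infinity>" by (auto simp: less_top)
qed

text \<open>If the cylinder of \<open>l\<close> were null, the measure of prefixed sets would vanish
  identically, and so would its derivative a.e. on the cylinder of the source. That cylinder has
  positive mass and the derivative is positive a.e. there.\<close>

lemma semibranching_cyl_pos:
  assumes sb: "std_semibranching G M" and l: "l \<in> Mor G"
  shows "emeasure M (cyl G l) \<noteq> 0"
proof
  assume 0: "emeasure M (cyl G l) = 0"
  have M: "sets M = sets (path_space G)" using sb by (simp add: std_semibranching_def)
  let ?R = "restrict_space M (cyl G (src G l))" and ?N = "comp_prefix_measure G M l"
  have Z: "cyl G l \<in> sets M" "cyl G (src G l) \<in> sets M" using l cyl_sets M kgraph_simps by auto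
  have sp: "space ?R = cyl G (src G l)"
    using sets.sets_into_space[OF Z(2)] by (auto simp: space_restrict_space)
  have "emeasure M (prefix G l ` A) = 0" if "A \<in> sigma_sets (cyl G (src G l)) (sets ?R)" for A
  proof -
    have "A \<subseteq> cyl G (src G l)"
      using that sets.sigma_sets_eq[of ?R] sets.sets_into_space[of A ?R] sp by auto
    hence "prefix G l ` A \<subseteq> cyl G l" using prefix_cyl[OF l] by auto
    from emeasure_mono[OF this Z(1)] show ?thesis using 0 by simp
  qed
  \<comment> \<open>\<open>sigma\<close> carries the zero measure. As \<open>measure_of\<close>
    depends only on the values on measurable sets, no additivity has to be checked.\<close>
  hence N: "?N = sigma (cyl G (src G l)) (sets ?R)"
    unfolding comp_prefix_measure_def
    by (intro measure_of_eq) (use sets.space_closed[of ?R] sp in auto)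
  have "density ?R (\<lambda>_. 0) = ?N"
    unfolding N by (rule measure_eqI) (use sets.sigma_sets_eq[of ?R] sets.space_closed[of ?R] sp in
        \<open>auto simp: emeasure_sigma emeasure_density\<close>)
  from RN_derivI[OF _ this] have "density ?R (RN_deriv ?R ?N) = ?N" by simp
  hence "emeasure (density ?R (RN_deriv ?R ?N)) (space ?R) = 0" by (simp add: N emeasure_sigma)
  hence "(\<integral>\<^sup>+x. RN_deriv ?R ?N x \<partial>?R) = 0"
    by (subst (asm) emeasure_density) (auto cong: nn_integral_cong_simp)
  hence "AE x in ?R. RN_deriv ?R ?N x = 0" by (subst (asm) nn_integral_0_iff_AE) auto
  moreover have "AE x in ?R. RN_deriv ?R ?N x > 0"
    using sb l by (simp add: std_semibranching_def)
  ultimately have "AE x in ?R. x \<notin> space ?R" by eventually_elim auto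
  hence "emeasure ?R (space ?R) = 0"
    by (intro null_setsD1 AE_iff_null_sets[OF sets.top, THEN iffD2])
  hence "emeasure M (cyl G (src G l)) = 0"
    using Z by (simp add: sp emeasure_restrict_space)
  thus False using sb vertex_src[OF l] by (auto simp: std_semibranching_def)
qed

text \<open>The substance is the push-forward identity. Without a density \<open>RN_deriv\<close>
  would be 0, so \<open>f l\<close> would vanish a.e., although it is nonzero a.e. on a cylinder of
  positive mass.\<close>

lemma projective_weighted_branch:
  assumes P: "std_projective_system G M f" and l: "l \<in> Mor G"
  shows "weighted_branch M (cyl G l) (cyl G (src G l)) (shift (deg G l)) (prefix G l) (f l)"
proof
  have sb: "std_semibranching G M" using P by (simp add: std_projective_system_def)
  hence M: "sets M = sets (path_space G)" by (simp add: std_semibranching_def)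
  show "cyl G l \<in> sets M" and "cyl G (src G l) \<in> sets M" using l cyl_sets M kgraph_simps by auto
  note Z = this(1)
  show "shift (deg G l) \<in> measurable M M" by (rule shift_measurable[OF M])
  show "prefix G l \<in> measurable (restrict_space M (cyl G (src G l))) M" by (rule prefix_measurable[OF l M])
  show f [measurable]: "f l \<in> borel_measurable M" and nz: "AE x in M. x \<in> cyl G l \<longrightarrow> f l x \<noteq> 0"
    using P l by (auto simp: std_projective_system_def)
  have e: "AE x in M. ennreal ((f l x)\<^sup>2) = RN_deriv M (pushfwd_prefix G M l) x"
    using P l by (auto simp: std_projective_system_def)
  have "\<exists>u. u \<in> borel_measurable M \<and> density M u = pushfwd_prefix G M l"
  proof (rule ccontr)
    assume "\<not> ?thesis"
    hence "RN_deriv M (pushfwd_prefix G M l) = (\<lambda>_. 0)" by (auto simp: RN_deriv_def)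
    with e nz have "AE x in M. x \<notin> cyl G l" by (auto elim!: eventually_elim2)
    hence "emeasure M (cyl G l) = 0" using Z by (simp add: AE_iff_null_sets null_setsD1)
    thus False using semibranching_cyl_pos[OF sb l] by blast
  qed
  hence "density M (RN_deriv M (pushfwd_prefix G M l)) = pushfwd_prefix G M l"
    using RN_derivI by blast
  moreover have "density M (\<lambda>x. ennreal ((f l x)\<^sup>2)) = density M (RN_deriv M (pushfwd_prefix G M l))"
    by (rule density_cong) (use e in auto)
  ultimately show "density M (\<lambda>x. ennreal ((f l x)\<^sup>2))
      = distr (restrict_space M (cyl G (src G l))) M (prefix G l)"
    by (simp add: pushfwd_prefix_def)
qed (use l prefix_cyl shift_cyl shift_prefix prefix_shift in auto)

section \<open>Intertwiners and cylinders\<close>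

lemma subrepD:
  assumes "subrep G M f H"
  shows "closed_subspace_L2 M H"
    and "l \<in> Mor G \<Longrightarrow> g \<in> H \<Longrightarrow> Top G f l g \<in> H"
    and "l \<in> Mor G \<Longrightarrow> g \<in> orth_L2 M H \<Longrightarrow> Top G f l g \<in> orth_L2 M H"
  using assms by (auto simp: subrep_def)

text \<open>\<open>h\<close> is the adjoint applied to \<open>g\<close>. The witness is exported
  because an intertwiner is only known to commute with the operators \<open>Top G f l\<close>
  themselves.\<close>

lemma subrep_cyl:
  assumes P: "std_projective_system G M f" and H: "subrep G M f H" and l: "l \<in> Mor G" and g: "g \<in> H"
  obtains h where "h \<in> H" "(\<lambda>x. indicator (cyl G l) x * g x) \<in> H"
    "AE x in M. Top G f l h x = indicator (cyl G l) x * g x"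
proof -
  interpret weighted_branch M "cyl G l" "cyl G (src G l)" "shift (deg G l)" "prefix G l" "f l"
    using P l by (rule projective_weighted_branch)
  have T: "T k = Top G f l k" for k by (simp add: T_def Top_def)
  have S: "S g \<in> H"
    by (rule reducing_S[OF subrepD(1)[OF H] _ g]) (use subrepD(3)[OF H l] T in auto)
  have TS: "AE x in M. Top G f l (S g) x = indicator (cyl G l) x * g x"
    using T_S[of g] by (simp add: T)
  have "(\<lambda>x. indicator (cyl G l) x * g x) \<in> H"
    by (rule closed_subspace_L2D(5)[OF subrepD(1)[OF H] subrepD(2)[OF H l S] _ TS])
      (rule indicator_L2[OF closed_subspace_L2D(1)[OF subrepD(1)[OF H] g] R_sets])
  with S TS that show ?thesis by blast
qed

text \<open>The image of the piece of \<open>g\<close> on a cylinder is supported in that cylinder,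
  being a.e. of the form \<open>Top G f' n (U h)\<close>. The piece on \<open>l\<close> and the
  piece on the other cylinders of the same degree add up to \<open>g\<close>; their images have
  disjoint supports and add up to \<open>U g\<close>, so the first image is the restriction of
  \<open>U g\<close>.\<close>

lemma intertwiner_commutes_cyl:
  assumes fin: "finite_kgraph G"
    and P: "std_projective_system G M f" and P': "std_projective_system G M' f'"
    and H: "subrep G M f H"
    and ae: "\<And>g h. g \<in> H \<Longrightarrow> h \<in> H \<Longrightarrow> AE x in M. g x = h x \<Longrightarrow> AE x in M'. U g x = U h x"
    and lin: "\<And>g h a b. g \<in> H \<Longrightarrow> h \<in> H \<Longrightarrow>
        AE x in M'. U (\<lambda>y. a * g y + b * h y) x = a * U g x + b * U h x"
    and inter: "\<And>l g. l \<in> Mor G \<Longrightarrow> g \<in> H \<Longrightarrow> AE x in M'. U (Top G f l g) x = Top G f' l (U g) x"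
    and l: "l \<in> Mor G" and g: "g \<in> H"
  shows "AE x in M'. U (\<lambda>x. indicator (cyl G l) x * g x) x = indicator (cyl G l) x * U g x"
proof -
  note C = subrepD(1)[OF H]
  have M: "sets M = sets (path_space G)" and M': "sets M' = sets (path_space G)"
    using P P' by (auto simp: std_projective_system_def std_semibranching_def)
  have one: "AE x in M'. x \<notin> cyl G n \<longrightarrow> U (\<lambda>x. indicator (cyl G n) x * g x) x = 0" if n: "n \<in> Mor G" for n
  proof -
    interpret M': weighted_branch M' "cyl G n" "cyl G (src G n)" "shift (deg G n)" "prefix G n" "f' n"
      using P' n by (rule projective_weighted_branch)
    obtain h where h: "h \<in> H" "(\<lambda>x. indicator (cyl G n) x * g x) \<in> H"
      "AE x in M. Top G f n h x = indicator (cyl G n) x * g x"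
      using subrep_cyl[OF P H n g] by blast
    have "AE x in M'. U (Top G f n h) x = U (\<lambda>x. indicator (cyl G n) x * g x) x"
      by (rule ae[OF subrepD(2)[OF H n h(1)] h(2,3)])
    with inter[OF n h(1)] M'.w_zero show ?thesis
      by eventually_elim (auto simp: Top_def)
  qed
  \<comment> \<open>\<open>U\<close> is linear only in two terms at a time and up to null sets,
    hence an induction over finite sets of cylinders.\<close>
  have many: "(\<lambda>x. indicator (\<Union>n\<in>F. cyl G n) x * g x) \<in> H \<and>
      (AE x in M'. x \<notin> (\<Union>n\<in>F. cyl G n) \<longrightarrow> U (\<lambda>x. indicator (\<Union>n\<in>F. cyl G n) x * g x) x = 0)"
    if "finite F" "F \<subseteq> {n \<in> Mor G. deg G n = deg G l}" for F
    using that
  proof (induction F rule: finite_induct)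
    case empty
    have "AE x in M'. U (\<lambda>x. 0) x = 0"
      using lin[OF closed_subspace_L2D(2)[OF C] closed_subspace_L2D(2)[OF C], of 0 0] by simp
    thus ?case using closed_subspace_L2D(2)[OF C] by (auto elim: eventually_mono)
  next
    case (insert n F)
    let ?W = "\<Union>n\<in>F. cyl G n"
    have n: "n \<in> Mor G" using insert by auto
    have IH: "(\<lambda>x. indicator ?W x * g x) \<in> H"
      "AE x in M'. x \<notin> ?W \<longrightarrow> U (\<lambda>x. indicator ?W x * g x) x = 0"
      using insert by auto
    have gn: "(\<lambda>x. indicator (cyl G n) x * g x) \<in> H" using subrep_cyl[OF P H n g] by blast
    have "cyl G n \<inter> cyl G m = {}" if "m \<in> F" for m
      using that insert by (intro cyl_disjoint) auto
    hence "cyl G n \<inter> ?W = {}" by auto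
    hence eq: "(\<lambda>x. indicator (\<Union>n\<in>insert n F. cyl G n) x * g x)
        = (\<lambda>x. 1 * (indicator (cyl G n) x * g x) + 1 * (indicator ?W x * g x))"
      by (auto simp: indicator_def fun_eq_iff)
    have "(\<lambda>x. indicator (\<Union>n\<in>insert n F. cyl G n) x * g x) \<in> H"
      unfolding eq using closed_subspace_L2D(3)[OF C gn IH(1)] by simp
    moreover have "AE x in M'. x \<notin> (\<Union>n\<in>insert n F. cyl G n) \<longrightarrow>
        U (\<lambda>x. indicator (\<Union>n\<in>insert n F. cyl G n) x * g x) x = 0"
      unfolding eq using lin[OF gn IH(1), of 1 1] IH(2) one[OF n]
      by eventually_elim auto
    ultimately show ?case by blast
  qed
  define F where "F = {n \<in> Mor G. deg G n = deg G l} - {l}"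
  let ?W = "\<Union>n\<in>F. cyl G n"
  have "finite F" using fin by (simp add: F_def finite_kgraph_def)
  hence W: "(\<lambda>x. indicator ?W x * g x) \<in> H"
      "AE x in M'. x \<notin> ?W \<longrightarrow> U (\<lambda>x. indicator ?W x * g x) x = 0"
    using many[of F] by (auto simp: F_def)
  have gl: "(\<lambda>x. indicator (cyl G l) x * g x) \<in> H" using subrep_cyl[OF P H l g] by blast
  have "cyl G l \<inter> cyl G m = {}" if "m \<in> F" for m
    using that by (intro cyl_disjoint) (auto simp: F_def)
  hence dis: "cyl G l \<inter> ?W = {}" by auto
  have cov: "ipaths G = cyl G l \<union> ?W" using UN_cyl[of "deg G l"] l by (auto simp: F_def)
  \<comment> \<open>The trivial coefficients match the form in which linearity of \<open>U\<close>
    is given.\<close>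
  let ?k = "\<lambda>x. 1 * (indicator (cyl G l) x * g x) + 1 * (indicator ?W x * g x)"
  have kH: "?k \<in> H" using closed_subspace_L2D(3)[OF C gl W(1)] by simp
  have "AE x in M. g x = ?k x"
    using dis cov by (intro AE_I2) (auto simp: space_eq[OF M] indicator_def)
  from ae[OF g kH this] lin[OF gl W(1), of 1 1] W(2) one[OF l] AE_space[of M']
  show ?thesis
  proof eventually_elim
    case (elim x)
    have "x \<in> cyl G l \<union> ?W" using elim(5) cov by (simp add: space_eq[OF M'])
    thus ?case using elim dis by (auto simp: indicator_def)
  qed
qed

text \<open>On a cylinder the two sides are the squared norms of the piece of \<open>g\<close> and
  of its image under \<open>U\<close>, which \<open>intertwiner_commutes_cyl\<close> identifies with
  the piece of \<open>U g\<close>. Finite measures agreeing on \<open>diag_cyls\<close> are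
  equal.\<close>

lemma equivalent_subreps_same_spectral_measure:
  assumes fin: "finite_kgraph G"
    and P: "std_projective_system G M f" and P': "std_projective_system G M' f'"
    and H: "subrep G M f H" and H': "subrep G M' f' H'"
    and maps: "\<And>g. g \<in> H \<Longrightarrow> U g \<in> H'"
    and ae: "\<And>g h. g \<in> H \<Longrightarrow> h \<in> H \<Longrightarrow> AE x in M. g x = h x \<Longrightarrow> AE x in M'. U g x = U h x"
    and lin: "\<And>g h a b. g \<in> H \<Longrightarrow> h \<in> H \<Longrightarrow>
        AE x in M'. U (\<lambda>y. a * g y + b * h y) x = a * U g x + b * U h x"
    and iso: "\<And>g. g \<in> H \<Longrightarrow> (\<integral>x. (cmod (U g x))\<^sup>2 \<partial>M') = (\<integral>x. (cmod (g x))\<^sup>2 \<partial>M)"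
    and inter: "\<And>l g. l \<in> Mor G \<Longrightarrow> g \<in> H \<Longrightarrow> AE x in M'. U (Top G f l g) x = Top G f' l (U g) x"
    and g: "g \<in> H"
  shows "density M (\<lambda>x. ennreal ((cmod (g x))\<^sup>2)) = density M' (\<lambda>x. ennreal ((cmod (U g x))\<^sup>2))"
    (is "?N = ?N'")
proof (rule measure_eqI_generator_eq_countable)
  have M: "sets M = sets (path_space G)" and M': "sets M' = sets (path_space G)"
    using P P' by (auto simp: std_projective_system_def std_semibranching_def)
  have gL: "g \<in> L2 M" using closed_subspace_L2D(1)[OF subrepD(1)[OF H] g] .
  have UL: "U h \<in> L2 M'" if "h \<in> H" for h
    using closed_subspace_L2D(1)[OF subrepD(1)[OF H'] maps[OF that]] .
  have sq: "(\<integral>\<^sup>+x. ennreal ((cmod (k x))\<^sup>2) \<partial>N) = ennreal (\<integral>x. (cmod (k x))\<^sup>2 \<partial>N)"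
    if "k \<in> L2 N" for k :: "('a,'k) ipath \<Rightarrow> complex" and N
    using L2_integrable[OF that] by (intro nn_integral_eq_integral) auto
  show "Int_stable diag_cyls" by (rule Int_stable_diag_cyls)
  show "diag_cyls \<subseteq> Pow (ipaths G)" by (rule diag_cyls_subset)
  show "sets ?N = sigma_sets (ipaths G) diag_cyls" "sets ?N' = sigma_sets (ipaths G) diag_cyls"
    using M M' sets_path_space_diag by auto
  have "emeasure ?N (cyl G l) = emeasure ?N' (cyl G l)" if l: "l \<in> Mor G" for l
  proof -
    let ?k = "\<lambda>x. indicator (cyl G l) x * g x"
    have Z: "cyl G l \<in> sets M" "cyl G l \<in> sets M'" using l M M' cyl_sets by auto
    have k: "?k \<in> H" using subrep_cyl[OF P H l g] by blast
    have U: "AE x in M'. U ?k x = indicator (cyl G l) x * U g x"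
      by (rule intertwiner_commutes_cyl[OF fin P P' H ae lin inter l g])
    have "emeasure ?N (cyl G l) = (\<integral>\<^sup>+x. ennreal ((cmod (?k x))\<^sup>2) \<partial>M)"
      using Z L2_measurable[OF gL]
      by (subst emeasure_density) (auto intro!: nn_integral_cong simp: indicator_def)
    also have "\<dots> = ennreal (\<integral>x. (cmod (?k x))\<^sup>2 \<partial>M)"
      by (rule sq[OF closed_subspace_L2D(1)[OF subrepD(1)[OF H] k]])
    also have "\<dots> = (\<integral>\<^sup>+x. ennreal ((cmod (U ?k x))\<^sup>2) \<partial>M')"
      using iso[OF k] sq[OF UL[OF k]] by simp
    also have "\<dots> = (\<integral>\<^sup>+x. ennreal ((cmod (U g x))\<^sup>2) * indicator (cyl G l) x \<partial>M')"
      by (intro nn_integral_cong_AE eventually_mono[OF U]) (auto simp: indicator_def)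
    also have "\<dots> = emeasure ?N' (cyl G l)"
      using Z L2_measurable[OF UL[OF g]] by (subst emeasure_density) auto
    finally show ?thesis .
  qed
  thus "emeasure ?N X = emeasure ?N' X" if "X \<in> diag_cyls" for X
    using that by (auto simp: diag_cyls_def)
  \<comment> \<open>The degree 0 is constant, so these cylinders belong to \<open>diag_cyls\<close>;
    they cover the space, as the uniqueness theorem demands.\<close>
  let ?A = "cyl G ` {l \<in> Mor G. deg G l = 0}"
  show "?A \<subseteq> diag_cyls" by (auto simp: diag_cyls_def zero_fun_def)
  show "\<Union> ?A = ipaths G" using UN_cyl[of 0] by simp
  show "countable ?A" by (auto intro: countable_subset[OF _ countable_Mor])
  have lt: "(\<integral>\<^sup>+x. ennreal ((cmod (g x))\<^sup>2) \<partial>M) < \<infinity>" using sq[OF gL] by simp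
  have "emeasure ?N a \<le> (\<integral>\<^sup>+x. ennreal ((cmod (g x))\<^sup>2) \<partial>M)" for a
  proof -
    have "emeasure ?N a \<le> emeasure ?N (space ?N)" by (rule emeasure_space)
    also have "\<dots> = (\<integral>\<^sup>+x. ennreal ((cmod (g x))\<^sup>2) \<partial>M)"
      using L2_measurable[OF gL] by (subst emeasure_density) (auto intro!: nn_integral_cong)
    finally show ?thesis .
  qed
  from le_less_trans[OF this lt] show "emeasure ?N a \<noteq> \<infinity>" for a by (simp add: less_top)
qed

lemma singular_imp_disjoint:
  assumes fin: "finite_kgraph G"
    and P: "std_projective_system G M f" and P': "std_projective_system G M' f'"
    and sing: "mutually_singular M M'"
  shows "reps_disjoint G M f M' f'"
  unfolding reps_disjoint_def
proof (intro notI, elim exE conjE)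
  fix H H'
  assume H: "subrep G M f H" and H': "subrep G M' f' H'" and nz: "nonzero_L2 M H"
    and ue: "unit_equiv G M f H M' f' H'"
  from ue[unfolded unit_equiv_def] obtain U where U:
    "\<forall>g\<in>H. U g \<in> H'"
    "\<forall>g\<in>H. \<forall>h\<in>H. (AE x in M. g x = h x) \<longrightarrow> (AE x in M'. U g x = U h x)"
    "\<forall>g\<in>H. \<forall>h\<in>H. \<forall>a b. AE x in M'. U (\<lambda>y. a * g y + b * h y) x = a * U g x + b * U h x"
    "\<forall>g\<in>H. (\<integral>x. (cmod (U g x))\<^sup>2 \<partial>M') = (\<integral>x. (cmod (g x))\<^sup>2 \<partial>M)"
    "\<forall>l\<in>Mor G. \<forall>g\<in>H. AE x in M'. U (Top G f l g) x = Top G f' l (U g) x"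
    by (elim exE conjE)
  note U = U[rule_format]
  from nz obtain g where g: "g \<in> H" "\<not> (AE x in M. g x = 0)" by (auto simp: nonzero_L2_def)
  have eq: "density M (\<lambda>x. ennreal ((cmod (g x))\<^sup>2)) = density M' (\<lambda>x. ennreal ((cmod (U g x))\<^sup>2))"
    by (rule equivalent_subreps_same_spectral_measure[OF fin P P' H H' U g(1)])
  have gm [measurable]: "g \<in> borel_measurable M" "U g \<in> borel_measurable M'"
    using closed_subspace_L2D(1)[OF subrepD(1)[OF H] g(1)]
      closed_subspace_L2D(1)[OF subrepD(1)[OF H'] U(1)[OF g(1)]] L2_measurable by auto
  obtain A where A: "A \<in> sets M" "A \<in> sets M'" "emeasure M A = 0" "emeasure M' (space M' - A) = 0"
    using sing by (auto simp: mutually_singular_def)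
  have "AE x in M. x \<notin> A" using A AE_iff_null_sets[of A M] by (auto simp: null_sets_def)
  hence "AE x in density M (\<lambda>x. ennreal ((cmod (g x))\<^sup>2)). x \<notin> A"
    by (subst AE_density) auto
  moreover have "AE x in M'. x \<notin> space M' - A"
    using A AE_iff_null_sets[of "space M' - A" M'] by (auto simp: null_sets_def)
  hence "AE x in density M' (\<lambda>x. ennreal ((cmod (U g x))\<^sup>2)). x \<notin> space M' - A"
    by (subst AE_density) auto
  hence "AE x in density M' (\<lambda>x. ennreal ((cmod (U g x))\<^sup>2)). x \<in> A"
    using AE_space by eventually_elim auto
  ultimately have "AE x in density M (\<lambda>x. ennreal ((cmod (g x))\<^sup>2)). False"
    unfolding eq by eventually_elim auto
  hence "AE x in M. g x = 0" by (subst (asm) AE_density) (auto elim: eventually_mono)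
  with g show False by blast
qed

end

section \<open>Subrepresentations carried by an invariant set\<close>

definition supported_L2 :: "'b measure \<Rightarrow> 'b set \<Rightarrow> ('b \<Rightarrow> complex) set" where
  "supported_L2 M A = {g \<in> L2 M. AE x in M. x \<notin> A \<longrightarrow> g x = 0}"

lemma closed_subspace_supported_L2:
  assumes A [measurable]: "A \<in> sets M"
  shows "closed_subspace_L2 M (supported_L2 M A)"
  unfolding closed_subspace_L2_def
proof (intro conjI ballI allI impI)
  show "supported_L2 M A \<subseteq> L2 M" by (auto simp: supported_L2_def)
  show "(\<lambda>x. 0) \<in> supported_L2 M A" by (auto simp: supported_L2_def L2_def)
next
  fix g h assume "g \<in> supported_L2 M A" "h \<in> supported_L2 M A"
  thus "(\<lambda>x. g x + h x) \<in> supported_L2 M A"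
    unfolding supported_L2_def by (auto intro: L2_add elim: eventually_elim2)
next
  fix c g assume "g \<in> supported_L2 M A"
  thus "(\<lambda>x. c * g x) \<in> supported_L2 M A"
    unfolding supported_L2_def by (auto intro: L2_scale elim: eventually_mono)
next
  fix g h assume "g \<in> supported_L2 M A" "h \<in> L2 M" "AE x in M. g x = h x"
  thus "h \<in> supported_L2 M A"
    unfolding supported_L2_def by (auto elim: eventually_elim2)
next
  fix s h assume s: "\<forall>n. s n \<in> supported_L2 M A" and h: "h \<in> L2 M"
    and lim: "(\<lambda>n. \<integral>x. (cmod (s n x - h x))\<^sup>2 \<partial>M) \<longlonglongrightarrow> 0"
  have sL: "s n \<in> L2 M" for n using s by (simp add: supported_L2_def)
  \<comment> \<open>Outside \<open>A\<close> every \<open>s n\<close> is 0, so the part of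
    \<open>h\<close> outside \<open>A\<close> has norm at most the distance from \<open>s n\<close>
    to \<open>h\<close>, which tends to 0.\<close>
  let ?k = "\<lambda>x. indicator (space M - A) x * h x"
  have k: "?k \<in> L2 M" by (rule indicator_L2[OF h]) simp
  have "(\<integral>x. (cmod (?k x))\<^sup>2 \<partial>M) \<le> (\<integral>x. (cmod (s n x - h x))\<^sup>2 \<partial>M)" for n
  proof (rule integral_mono_AE)
    have "AE x in M. x \<notin> A \<longrightarrow> s n x = 0" using s by (simp add: supported_L2_def)
    thus "AE x in M. (cmod (?k x))\<^sup>2 \<le> (cmod (s n x - h x))\<^sup>2"
      by eventually_elim (auto simp: indicator_def)
  qed (intro L2_integrable k L2_diff sL h)+
  hence "(\<integral>x. (cmod (?k x))\<^sup>2 \<partial>M) \<le> 0"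
    by (intro LIMSEQ_le_const[OF lim]) auto
  hence "(\<integral>x. (cmod (?k x))\<^sup>2 \<partial>M) = 0" by (intro antisym) auto
  from L2_sq_norm_eq_0[OF k this] AE_space have "AE x in M. x \<notin> A \<longrightarrow> h x = 0"
    by eventually_elim (auto simp: indicator_def)
  thus "h \<in> supported_L2 M A" using h by (simp add: supported_L2_def)
qed

lemma orth_supported_L2:
  assumes A [measurable]: "A \<in> sets M"
  shows "orth_L2 M (supported_L2 M A) = {g \<in> L2 M. AE x in M. x \<in> A \<longrightarrow> g x = 0}"
proof (intro equalityI subsetI CollectI conjI)
  fix g assume g: "g \<in> orth_L2 M (supported_L2 M A)"
  thus gL: "g \<in> L2 M" by (simp add: orth_L2_def)
  \<comment> \<open>Testing \<open>g\<close> against its own restriction to \<open>A\<close> yields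
    the squared norm of that restriction.\<close>
  let ?k = "\<lambda>x. indicator A x * g x"
  have k: "?k \<in> L2 M" by (rule indicator_L2[OF gL A])
  hence "?k \<in> supported_L2 M A" by (simp add: supported_L2_def)
  hence "(\<integral>x. g x * cnj (?k x) \<partial>M) = 0" using g by (auto simp: orth_L2_def)
  moreover have "(\<integral>x. g x * cnj (?k x) \<partial>M) = (\<integral>x. complex_of_real ((cmod (?k x))\<^sup>2) \<partial>M)"
    by (intro Bochner_Integration.integral_cong refl, simp only: complex_norm_square)
      (simp add: indicator_def)
  ultimately have "(\<integral>x. (cmod (?k x))\<^sup>2 \<partial>M) = 0"
    by (metis integral_complex_of_real of_real_eq_0_iff)
  from L2_sq_norm_eq_0[OF k this] show "AE x in M. x \<in> A \<longrightarrow> g x = 0"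
    by eventually_elim (auto simp: indicator_def)
next
  fix g assume "g \<in> {g \<in> L2 M. AE x in M. x \<in> A \<longrightarrow> g x = 0}"
  hence g: "g \<in> L2 M" "AE x in M. x \<in> A \<longrightarrow> g x = 0" by auto
  show "g \<in> orth_L2 M (supported_L2 M A)"
    unfolding orth_L2_def
  proof (intro CollectI conjI ballI g(1))
    fix h assume "h \<in> supported_L2 M A"
    hence "AE x in M. x \<notin> A \<longrightarrow> h x = 0" by (simp add: supported_L2_def)
    with g(2) have "AE x in M. g x * cnj (h x) = 0"
      by eventually_elim auto
    thus "(\<integral>x. g x * cnj (h x) \<partial>M) = 0" by (rule integral_eq_zero_AE)
  qed
qed

context k_graph
begin

lemma subrep_supported_L2:
  assumes P: "std_projective_system G M f" and A: "A \<in> sets M"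
    and inv: "\<And>l. l \<in> Mor G \<Longrightarrow> AE x in M. x \<in> cyl G l \<longrightarrow> (shift (deg G l) x \<in> A \<longleftrightarrow> x \<in> A)"
  shows "subrep G M f (supported_L2 M A)"
  unfolding subrep_def
proof (intro conjI ballI closed_subspace_supported_L2[OF A])
  fix l g assume l: "l \<in> Mor G" and g: "g \<in> supported_L2 M A"
  interpret weighted_branch M "cyl G l" "cyl G (src G l)" "shift (deg G l)" "prefix G l" "f l"
    using P l by (rule projective_weighted_branch)
  have T: "Top G f l k = T k" for k by (simp add: T_def Top_def)
  have gL: "g \<in> L2 M" and "AE x in M. x \<notin> A \<longrightarrow> g x = 0" using g by (auto simp: supported_L2_def)
  hence g0: "AE x in M. x \<in> space M - A \<longrightarrow> g x = 0" by (auto elim: eventually_mono)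
  have "AE x in M. x \<in> cyl G l \<longrightarrow> (shift (deg G l) x \<in> space M - A \<longleftrightarrow> x \<in> space M - A)"
    using inv[OF l] AE_space
  proof eventually_elim
    case (elim x)
    thus ?case using measurable_space[OF s_measurable elim(2)] by blast
  qed
  from T_vanishes_on[OF L2_measurable[OF gL] _ g0 this] A AE_space
  have "AE x in M. x \<in> space M - A \<longrightarrow> T g x = 0" by auto
  with AE_space have "AE x in M. x \<notin> A \<longrightarrow> T g x = 0" by eventually_elim auto
  thus "Top G f l g \<in> supported_L2 M A" using T_L2[OF gL] by (simp add: T supported_L2_def)
next
  fix l g assume l: "l \<in> Mor G" and g: "g \<in> orth_L2 M (supported_L2 M A)"
  interpret weighted_branch M "cyl G l" "cyl G (src G l)" "shift (deg G l)" "prefix G l" "f l"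
    using P l by (rule projective_weighted_branch)
  have T: "Top G f l k = T k" for k by (simp add: T_def Top_def)
  have gL: "g \<in> L2 M" and g0: "AE x in M. x \<in> A \<longrightarrow> g x = 0"
    using g by (auto simp: orth_supported_L2[OF A])
  from T_vanishes_on[OF L2_measurable[OF gL] A g0 inv[OF l]]
  show "Top G f l g \<in> orth_L2 M (supported_L2 M A)"
    using T_L2[OF gL] by (simp add: T orth_supported_L2[OF A])
qed

text \<open>\<open>dens\<close> makes multiplication by the root of \<open>rho\<close> isometric on
  functions supported in \<open>A\<close>, and \<open>cocycle\<close> is the intertwining relation
  at points. \<open>U\<close> is defined on all functions and is 0 off \<open>A\<close>, so its
  linearity holds pointwise.\<close>

lemma unit_equiv_supported_L2:
  assumes P: "std_projective_system G M f" and P': "std_projective_system G M' f'"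
    and A: "A \<in> sets M" and rho: "rho \<in> borel_measurable M" "\<And>x. rho x > (0::real)"
    and dens: "density M (indicator A) = density M' (\<lambda>x. indicator A x * ennreal (rho x))"
    and cocycle: "\<And>l. l \<in> Mor G \<Longrightarrow>
      AE x in M'. x \<in> A \<longrightarrow> sqrt (rho x) * f l x = sqrt (rho (shift (deg G l) x)) * f' l x"
    and inv': "\<And>l. l \<in> Mor G \<Longrightarrow> AE x in M'. x \<in> cyl G l \<longrightarrow> (shift (deg G l) x \<in> A \<longleftrightarrow> x \<in> A)"
    and transfer: "\<And>Q. (AE x in M. x \<in> A \<longrightarrow> Q x) \<longleftrightarrow> (AE x in M'. x \<in> A \<longrightarrow> Q x)"
  shows "unit_equiv G M f (supported_L2 M A) M' f' (supported_L2 M' A)"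
proof -
  have sets_eq: "sets M' = sets M"
    using P P' by (auto simp: std_projective_system_def std_semibranching_def)
  note cong = measurable_cong_sets[OF sets_eq refl]
  have A' [measurable]: "A \<in> sets M" "A \<in> sets M'" using A sets_eq by auto
  have rho_m [measurable]: "rho \<in> borel_measurable M" "rho \<in> borel_measurable M'"
    using rho by (simp_all add: cong)
  define U where "U g = (\<lambda>x. if x \<in> A then complex_of_real (sqrt (rho x)) * g x else 0)"
    for g :: "('a, 'k) ipath \<Rightarrow> complex"
  have Um: "U g \<in> borel_measurable M'" if "g \<in> borel_measurable M" for g
  proof -
    have [measurable]: "g \<in> borel_measurable M'" using that by (simp add: cong)
    show ?thesis unfolding U_def by measurable
  qed
  have Unorm: "(\<integral>\<^sup>+x. ennreal ((cmod (U g x))\<^sup>2) \<partial>M') = (\<integral>\<^sup>+x. indicator A x * ennreal ((cmod (g x))\<^sup>2) \<partial>M)"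
    if g: "g \<in> borel_measurable M" for g
  proof -
    have [measurable]: "g \<in> borel_measurable M'" "g \<in> borel_measurable M" using g by (simp_all add: cong)
    have "(\<integral>\<^sup>+x. ennreal ((cmod (U g x))\<^sup>2) \<partial>M')
        = (\<integral>\<^sup>+x. (indicator A x * ennreal (rho x)) * ennreal ((cmod (g x))\<^sup>2) \<partial>M')"
      using rho(2) by (intro nn_integral_cong)
        (auto simp: U_def norm_mult power_mult_distrib ennreal_mult'' indicator_def less_imp_le)
    also have "\<dots> = (\<integral>\<^sup>+x. ennreal ((cmod (g x))\<^sup>2) \<partial>density M' (\<lambda>x. indicator A x * ennreal (rho x)))"
      by (rule nn_integral_density[symmetric]) measurable
    also have "\<dots> = (\<integral>\<^sup>+x. indicator A x * ennreal ((cmod (g x))\<^sup>2) \<partial>M)"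
      unfolding dens[symmetric] by (rule nn_integral_density) measurable
    finally show ?thesis .
  qed
  have L2I: "k \<in> L2 N" if "k \<in> borel_measurable N" "(\<integral>\<^sup>+x. ennreal ((cmod (k x))\<^sup>2) \<partial>N) < \<infinity>"
    for k :: "('a, 'k) ipath \<Rightarrow> complex" and N
  proof -
    have "integrable N (\<lambda>x. (cmod (k x))\<^sup>2)"
      using that by (intro integrableI_bounded) auto
    thus ?thesis using that by (simp add: L2_def)
  qed
  have L2D: "(\<integral>\<^sup>+x. ennreal ((cmod (k x))\<^sup>2) \<partial>N) = ennreal (\<integral>x. (cmod (k x))\<^sup>2 \<partial>N)"
    if "k \<in> L2 N" for k :: "('a, 'k) ipath \<Rightarrow> complex" and N
    using L2_integrable[OF that] by (intro nn_integral_eq_integral) auto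
  have Unorm': "(\<integral>\<^sup>+x. ennreal ((cmod (U g x))\<^sup>2) \<partial>M') = (\<integral>\<^sup>+x. ennreal ((cmod (g x))\<^sup>2) \<partial>M)"
    if "g \<in> supported_L2 M A" for g
  proof -
    have g0: "AE x in M. x \<notin> A \<longrightarrow> g x = 0" and gm: "g \<in> borel_measurable M"
      using that L2_measurable by (auto simp: supported_L2_def)
    show ?thesis unfolding Unorm[OF gm]
      by (intro nn_integral_cong_AE eventually_mono[OF g0]) (auto simp: indicator_def)
  qed
  have U_in: "U g \<in> supported_L2 M' A" if g: "g \<in> supported_L2 M A" for g
  proof -
    have gL: "g \<in> L2 M" using g by (simp add: supported_L2_def)
    have "U g \<in> L2 M'"
      by (rule L2I[OF Um[OF L2_measurable[OF gL]]]) (use Unorm'[OF g] L2D[OF gL] in simp)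
    thus ?thesis by (simp add: supported_L2_def U_def)
  qed
  show ?thesis
    unfolding unit_equiv_def
  proof (intro exI[of _ U] conjI ballI allI impI)
    fix g assume "g \<in> supported_L2 M A"
    thus "U g \<in> supported_L2 M' A" by (rule U_in)
  next
    fix g h :: "('a, 'k) ipath \<Rightarrow> complex" assume "AE x in M. g x = h x"
    hence "AE x in M. x \<in> A \<longrightarrow> g x = h x" by (auto elim: eventually_mono)
    hence "AE x in M'. x \<in> A \<longrightarrow> g x = h x" by (simp only: transfer)
    thus "AE x in M'. U g x = U h x" by eventually_elim (auto simp: U_def)
  next
    fix g h :: "('a, 'k) ipath \<Rightarrow> complex" and a b
    show "AE x in M'. U (\<lambda>y. a * g y + b * h y) x = a * U g x + b * U h x"
      by (auto simp: U_def algebra_simps)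
  next
    fix g assume g: "g \<in> supported_L2 M A"
    have "g \<in> L2 M" "U g \<in> L2 M'" using g U_in[OF g] by (auto simp: supported_L2_def)
    from Unorm'[OF g] L2D[OF this(1)] L2D[OF this(2)]
    show "(\<integral>x. (cmod (U g x))\<^sup>2 \<partial>M') = (\<integral>x. (cmod (g x))\<^sup>2 \<partial>M)" by simp
  next
    fix h' assume h': "h' \<in> supported_L2 M' A"
    define g where "g x = (if x \<in> A then h' x / complex_of_real (sqrt (rho x)) else 0)" for x
    have h'L: "h' \<in> L2 M'" "AE x in M'. x \<notin> A \<longrightarrow> h' x = 0" using h' by (auto simp: supported_L2_def)
    have h'm [measurable]: "h' \<in> borel_measurable M'" using h'L by (simp add: L2_measurable)
    have "g \<in> borel_measurable M'" unfolding g_def by measurable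
    hence gm: "g \<in> borel_measurable M" by (simp add: cong)
    have Ug: "AE x in M'. U g x = h' x"
      using h'L(2)
    proof eventually_elim
      case (elim x)
      thus ?case using rho(2)[of x] by (auto simp: U_def g_def)
    qed
    have "(\<integral>\<^sup>+x. ennreal ((cmod (g x))\<^sup>2) \<partial>M) = (\<integral>\<^sup>+x. indicator A x * ennreal ((cmod (g x))\<^sup>2) \<partial>M)"
      by (intro nn_integral_cong) (auto simp: g_def indicator_def)
    also have "\<dots> = (\<integral>\<^sup>+x. ennreal ((cmod (U g x))\<^sup>2) \<partial>M')" by (rule Unorm[OF gm, symmetric])
    also have "\<dots> = (\<integral>\<^sup>+x. ennreal ((cmod (h' x))\<^sup>2) \<partial>M')"
      by (intro nn_integral_cong_AE eventually_mono[OF Ug]) simp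
    also have "\<dots> < \<infinity>" using L2D[OF h'L(1)] by simp
    finally have "g \<in> supported_L2 M A" using L2I[OF gm] by (simp add: supported_L2_def g_def)
    with Ug show "\<exists>g\<in>supported_L2 M A. AE x in M'. U g x = h' x" by blast
  next
    fix l g assume l: "l \<in> Mor G"
    interpret M': weighted_branch M' "cyl G l" "cyl G (src G l)" "shift (deg G l)" "prefix G l" "f' l"
      using P' l by (rule projective_weighted_branch)
    show "AE x in M'. U (Top G f l g) x = Top G f' l (U g) x"
      using cocycle[OF l] inv'[OF l] M'.w_zero
    proof eventually_elim
      case (elim x)
      let ?y = "shift (deg G l) x"
      show ?case
      proof (cases "x \<in> A")
        case True
        have e: "complex_of_real (sqrt (rho x)) * complex_of_real (f l x)
          = complex_of_real (f' l x) * complex_of_real (sqrt (rho ?y))"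
          using elim(1) True by (metis of_real_mult mult.commute)
        show ?thesis
        proof (cases "x \<in> cyl G l")
          case True
          hence "?y \<in> A" using elim \<open>x \<in> A\<close> by simp
          thus ?thesis using \<open>x \<in> A\<close> e by (simp add: U_def Top_def mult.assoc[symmetric])
        next
          \<comment> \<open>Off the cylinder \<open>f l\<close> is known to vanish only
            \<open>M\<close>-a.e.; here it vanishes because \<open>f' l\<close> does and the factor
            in front of \<open>f l\<close> is positive.\<close>
          case False
          hence "f' l x = 0" using elim by simp
          hence "complex_of_real (sqrt (rho x)) * complex_of_real (f l x) = 0" using e by simp
          hence "f l x = 0" using rho(2)[of x] by auto
          thus ?thesis using \<open>f' l x = 0\<close> by (simp add: U_def Top_def)
        qed
      next
        case False
        thus ?thesis using elim by (cases "x \<in> cyl G l") (auto simp: U_def Top_def)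
      qed
    qed
  qed
qed

lemma disjoint_imp_singular:
  assumes fin: "finite_kgraph G"
    and P: "std_projective_system G M f" and f0: "\<forall>l\<in>Mor G. \<forall>x\<in>space M. f l x \<ge> 0"
    and P': "std_projective_system G M' f'" and f'0: "\<forall>l\<in>Mor G. \<forall>x\<in>space M'. f' l x \<ge> 0"
    and disj: "reps_disjoint G M f M' f'"
  shows "mutually_singular M M'"
proof (rule ccontr)
  assume nsing: "\<not> mutually_singular M M'"
  have sets_eq: "sets M' = sets M"
    using P P' by (auto simp: std_projective_system_def std_semibranching_def)
  have sp: "space M' = space M" using sets_eq by (rule sets_eq_imp_space_eq)
  have finM: "finite_measure M" and finM': "finite_measure M'"
    using projective_finite_measure[OF fin] P P' by auto
  obtain A B C rho where ABC: "A \<in> sets M" "B \<in> sets M" "C \<in> sets M" "A \<inter> B = {}" "A \<inter> C = {}"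
    "space M \<subseteq> A \<union> B \<union> C" and B: "AE x in M. x \<notin> B" and C: "AE x in M'. x \<notin> C"
    and rho: "rho \<in> borel_measurable M" "\<And>x. rho x > (0::real)"
    and dens: "density M (indicator A) = density M' (\<lambda>x. indicator A x * ennreal (rho x))"
    using Lebesgue_overlap[OF finM finM' sets_eq] by blast
  note cong = measurable_cong_sets[OF sets_eq refl]
  have [measurable]: "A \<in> sets M" "A \<in> sets M'" "rho \<in> borel_measurable M'"
    using ABC rho sets_eq by (simp_all add: cong)
  have transfer: "(AE x in M. x \<in> A \<longrightarrow> Q x) \<longleftrightarrow> (AE x in M'. x \<in> A \<longrightarrow> Q x)" for Q
  proof -
    have "(AE x in M. x \<in> A \<longrightarrow> Q x) \<longleftrightarrow> (AE x in density M (indicator A). Q x)"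
      by (subst AE_density) (auto simp: indicator_def)
    also have "\<dots> \<longleftrightarrow> (AE x in M'. x \<in> A \<longrightarrow> Q x)"
      unfolding dens using rho(2) by (subst AE_density) (auto simp: indicator_def)
    finally show ?thesis .
  qed
  note W = projective_weighted_branch[OF P] and W' = projective_weighted_branch[OF P']
  have inv: "AE x in M. x \<in> cyl G l \<longrightarrow> (shift (deg G l) x \<in> A \<longleftrightarrow> x \<in> A)" if "l \<in> Mor G" for l
    by (rule overlap_invariant[OF W[OF that] W'[OF that] sets_eq ABC(1-3,6,5) B C transfer])
  \<comment> \<open>Exchanging the measures exchanges \<open>B\<close> with \<open>C\<close>, so the
    same lemma applies.\<close>
  have inv': "AE x in M'. x \<in> cyl G l \<longrightarrow> (shift (deg G l) x \<in> A \<longleftrightarrow> x \<in> A)" if "l \<in> Mor G" for l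
    by (rule overlap_invariant[OF W'[OF that] W[OF that] sets_eq[symmetric] _ _ _ _ ABC(4) C B transfer[symmetric]])
      (use ABC sets_eq sp in auto)
  have cocycle: "AE x in M'. x \<in> A \<longrightarrow> sqrt (rho x) * f l x = sqrt (rho (shift (deg G l) x)) * f' l x"
    if l: "l \<in> Mor G" for l
    using branch_cocycle[OF W[OF l] W'[OF l] sets_eq finM' ABC(1) rho dens inv[OF l] inv'[OF l]] AE_space
  proof eventually_elim
    case (elim x)
    show ?case
    proof
      assume "x \<in> A"
      hence "sqrt (rho x * (f l x)\<^sup>2) = sqrt (rho (shift (deg G l) x) * (f' l x)\<^sup>2)" using elim by simp
      thus "sqrt (rho x) * f l x = sqrt (rho (shift (deg G l) x)) * f' l x"
        using f0 f'0 l elim(2) sp by (simp add: real_sqrt_mult)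
    qed
  qed
  \<comment> \<open>If \<open>A\<close> were \<open>M\<close>-null, then \<open>A \<union> B\<close>
    would be \<open>M\<close>-null while its complement lies in the \<open>M'\<close>-null set
    \<open>C\<close>, so the measures would be singular.\<close>
  have pos: "\<not> (AE x in M. x \<notin> A)"
  proof
    assume A0: "AE x in M. x \<notin> A"
    with B have "AE x in M. x \<notin> A \<union> B" by eventually_elim auto
    hence "emeasure M (A \<union> B) = 0" using ABC AE_iff_null_sets[of "A \<union> B" M] by auto
    moreover have "AE x in M'. x \<notin> space M' - (A \<union> B)"
      using C AE_space by eventually_elim (use ABC sp in auto)
    hence "emeasure M' (space M' - (A \<union> B)) = 0"
      using ABC sets_eq AE_iff_null_sets[of "space M' - (A \<union> B)" M'] by (auto simp: sp)
    ultimately have "mutually_singular M M'"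
      unfolding mutually_singular_def using ABC sets_eq by (intro bexI[of _ "A \<union> B"]) auto
    with nsing show False by blast
  qed
  have pos': "\<not> (AE x in M'. x \<notin> A)"
    using pos transfer[of "\<lambda>_. False"] by simp
  have nz: "nonzero_L2 N (supported_L2 N A)"
    if "finite_measure N" "A \<in> sets N" "\<not> (AE x in N. x \<notin> A)" for N
    unfolding nonzero_L2_def
  \<comment> \<open>Finiteness of the measure puts the indicator itself into
    \<open>L2\<close>.\<close>
  proof (intro bexI[of _ "indicator A"])
    interpret finite_measure N by fact
    have "integrable N (\<lambda>x. (cmod (indicator A x))\<^sup>2)"
      using that(2) by (intro integrable_const_bound[of _ 1]) (auto simp: indicator_def)
    thus "indicator A \<in> supported_L2 N A" using that(2) by (auto simp: supported_L2_def L2_def)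
    show "\<not> (AE x in N. indicator A x = (0::complex))"
      using that(3) by (simp add: indicator_eq_0_iff)
  qed
  have "subrep G M f (supported_L2 M A)"
    by (rule subrep_supported_L2[OF P ABC(1) inv])
  moreover have "subrep G M' f' (supported_L2 M' A)"
    by (rule subrep_supported_L2[OF P' _ inv']) (use ABC sets_eq in auto)
  moreover have "unit_equiv G M f (supported_L2 M A) M' f' (supported_L2 M' A)"
    by (rule unit_equiv_supported_L2[OF P P' ABC(1) rho dens cocycle inv' transfer])
  moreover have "nonzero_L2 M (supported_L2 M A)" "nonzero_L2 M' (supported_L2 M' A)"
    using nz[OF finM _ pos] nz[OF finM' _ pos'] ABC sets_eq by auto
  ultimately show False using disj unfolding reps_disjoint_def by blast
qed

end

theorem mainTheorem9:
  fixes G :: "('a, 'k::finite) kgraph"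
    and M M' :: "('a, 'k) ipath measure"
    and f f' :: "'a \<Rightarrow> ('a, 'k) ipath \<Rightarrow> real"
  assumes "is_kgraph G" and "finite_kgraph G" and "no_sources G"
    and "std_projective_system G M f" and "\<forall>l\<in>Mor G. \<forall>x\<in>space M. f l x \<ge> 0"
    and "std_projective_system G M' f'" and "\<forall>l\<in>Mor G. \<forall>x\<in>space M'. f' l x \<ge> 0"
  shows "reps_disjoint G M f M' f' \<longleftrightarrow> mutually_singular M M'"
proof -
  interpret k_graph G using assms(1) by unfold_locales
  show ?thesis
    using disjoint_imp_singular[OF assms(2,4-7)] singular_imp_disjoint[OF assms(2,4,6)] by blast
qed

end
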